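(* A numerical polynomial $\omega(s)$ is a Kolchin dimension polynomial (i.e. $\omega=\omega_E$ for some $m\ge 1$ and some $E\subset\mathbb{N}_0^m$) if and only if the sequence $(c_{d+1},c_d,\dots,c_1)$ of its Macaulay constants, where $d=\deg\omega$, is non-decreasing.
   Context: $\mathbb{N}_0$ is the set of non-negative integers. A numerical polynomial is a polynomial $\omega(s)$ in one variable $s$ taking integer values at integer points. For an integer $k$ and $i\ge 0$, $\binom{s+k}{i}$ denotes the polynomial $\frac{(s+k)(s+k-1)\cdots(s+k-i+1)}{i!}$ in $s$. Every numerical polynomial of degree $d$ can be written as $\omega(s)=\sum_{i=0}^{d}a_i\binom{s+i}{i}$ with $a_i\in\mathbb{Z}$; the numbers $(a_d,\dots,a_0)$ are its standard coefficients. Minimizing coefficients: the sequence $b(\omega)=(b_d,\dots,b_0)\in\mathbb{Z}^{d+1}$ of a numerical polynomial $\omega$ of degree $d$ is defined by induction on $d$. If $d=0$ (i.e. $\omega$ is a constant), then $b(\omega)=(\omega)$. If $d>0$ and $(a_d,\dots,a_0)$ are the standard coefficients of $\omega$, put $v(s)=\omega(s+a_d)-\binom{s+d+1+a_d}{d+1}+\binom{s+d+1}{d+1}$. Then $\deg v<d$; let $b(v)=(b_k,\dots,b_0)$, $0\le k<d$, be the sequence of minimizing coefficients of $v$, and define $b(\omega)=(a_d,0,\dots,0,b_k,\dots,b_0)\in\mathbb{Z}^{d+1}$. Macaulay constants: for a numerical polynomial $\omega$ of degree $d$ with minimizing coefficients $(b_d,\dots,b_0)$, they are $c_i=\sum_{j=i-1}^{d}b_j$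 for $i=1,\dots,d+1$; they satisfy $\omega(s)=\binom{s+d+1}{d+1}-\sum_{i=0}^{d+1}\binom{s+i-1-c_i}{i}$, where the value of $c_0$ can be set arbitrarily. Kolchin dimension polynomial: for $E\subset\mathbb{N}_0^m$ and $s\in\mathbb{N}_0$ let $V_E(s)$ be the set of $x=(x_1,\dots,x_m)\in\mathbb{N}_0^m$ with $x_1+\dots+x_m\le s$ such that for no $e\in E$ one has $e\le x$ in the componentwise partial order. For all sufficiently large $s$ the cardinality of $V_E(s)$ equals the value of a numerical polynomial, denoted $\omega_E(s)$ and called the Kolchin dimension polynomial of $E$.
   Formalization: The condition c_{d+1} ≥ 0 is added to the requirement that (c_{d+1},…,c_1) be non-decreasing; without it the claim fails, e.g. for ω = −1, whose sequence (−1) is non-decreasing although ω is not a Kolchin dimension polynomial. *)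

theory Defs
  imports Complex_Main "HOL-Computational_Algebra.Polynomial"
begin

definition numerical :: "real poly \<Rightarrow> bool" where
  "numerical p \<longleftrightarrow> (\<forall>n::int. poly p (of_int n) \<in> \<int>)"

text \<open>The polynomial \<open>s + k choose i\<close> in the variable \<open>s\<close>.\<close>

definition binom_poly :: "int \<Rightarrow> nat \<Rightarrow> real poly" where
  "binom_poly k i = smult (1 / fact i) (\<Prod>j<i. [:of_int k - of_nat j, 1:])"

lemma poly_binom_poly: "poly (binom_poly k i) x = (x + of_int k) gchoose i"
  by (simp add: binom_poly_def poly_prod gbinomial_prod_rev atLeast0LessThan algebra_simps)

lemma degree_binom_poly: "degree (binom_poly k i) = i"
  by (simp add: binom_poly_def degree_prod_eq_sum_degree)

lemma lead_coeff_binom_poly: "coeff (binom_poly k i) i = 1 / fact i"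
proof -
  have "lead_coeff (\<Prod>j<i. [:of_int k - of_nat j, 1::real:]) = 1"
    by (simp add: lead_coeff_prod)
  moreover have "degree (\<Prod>j<i. [:of_int k - of_nat j, 1::real:]) = i"
    by (simp add: degree_prod_eq_sum_degree)
  ultimately show ?thesis by (simp add: binom_poly_def)
qed

lemma binom_poly_0: "binom_poly k 0 = 1"
  by (simp add: binom_poly_def)

lemma binom_poly_Suc_diff:
  "binom_poly (k + 1) (Suc i) - binom_poly k (Suc i) = binom_poly k i"
proof -
  have "poly (binom_poly (k + 1) (Suc i) - binom_poly k (Suc i)) x = poly (binom_poly k i) x" for x
    using gbinomial_Suc_Suc[of "x + of_int k" i]
    by (simp add: poly_binom_poly add.assoc)
  then show ?thesis
    by (metis poly_eqI poly_eq_poly_eq_iff ext)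
qed

text \<open>Standard coefficients: \<open>std_coeff p i\<close> is \<open>a\<^sub>i\<close> in
  \<open>p(s) = \<Sum>i\<le>d. a\<^sub>i (s + i choose i)\<close>.  They are extended by \<open>0\<close> beyond the degree to
  make the function unique; \<open>std_coeff\<close> below is meaningful for numerical polynomials only,
  where \<open>std_coeff_unique\<close> applies.\<close>

definition is_std_coeff :: "real poly \<Rightarrow> (nat \<Rightarrow> int) \<Rightarrow> bool" where
  "is_std_coeff p a \<longleftrightarrow>
     p = (\<Sum>i\<le>degree p. smult (of_int (a i)) (binom_poly (int i) i)) \<and> (\<forall>i>degree p. a i = 0)"

definition std_coeff :: "real poly \<Rightarrow> nat \<Rightarrow> int" where
  "std_coeff p = (THE a. is_std_coeff p a)"

lemma coeff_binom_sum_top: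
  "coeff (\<Sum>i\<le>n. smult (of_int (a i)) (binom_poly (int i) i)) n = of_int (a n) / fact n"
proof -
  have "coeff (\<Sum>i\<le>n. smult (of_int (a i)) (binom_poly (int i) i)) n
      = (\<Sum>i\<le>n. of_int (a i) * coeff (binom_poly (int i) i) n)"
    by (simp add: coeff_sum)
  also have "\<dots> = (\<Sum>i\<in>{n}. of_int (a i) * coeff (binom_poly (int i) i) n)"
    by (rule sum.mono_neutral_right) (auto simp: coeff_eq_0 degree_binom_poly)
  also have "\<dots> = of_int (a n) / fact n"
    by (simp add: lead_coeff_binom_poly)
  finally show ?thesis .
qed

lemma binom_sum_inj:
  assumes "(\<Sum>i\<le>n. smult (of_int (a i)) (binom_poly (int i) i))
         = (\<Sum>i\<le>n. smult (of_int (b i)) (binom_poly (int i) i))" "i \<le> n"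
  shows "a i = b i"
  using assms
proof (induction n)
  case 0
  then show ?case using coeff_binom_sum_top[of a 0] coeff_binom_sum_top[of b 0] by simp
next
  case (Suc n)
  have top: "a (Suc n) = b (Suc n)"
    using Suc.prems(1) coeff_binom_sum_top[of a "Suc n"] coeff_binom_sum_top[of b "Suc n"]
    by (simp del: sum.atMost_Suc fact_Suc)
  show ?case
  proof (cases "i = Suc n")
    case True
    then show ?thesis using top by simp
  next
    case False
    then show ?thesis using Suc top by simp
  qed
qed

lemma numerical_binom_sum_exists:
  assumes "numerical p" "degree p \<le> n"
  shows "\<exists>a::nat \<Rightarrow> int. p = (\<Sum>i\<le>n. smult (of_int (a i)) (binom_poly (int i) i))"
  using assms
proof (induction n arbitrary: p)
  case 0
  then obtain c where c: "p = [:c:]" by (auto elim: degree_eq_zeroE)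
  have "c \<in> \<int>" using 0(1) c by (auto simp: numerical_def)
  then obtain z where "c = of_int z" by (auto elim: Ints_cases)
  then show ?case using c by (intro exI[of _ "\<lambda>_. z"]) (simp add: binom_poly_0)
next
  case (Suc n)
  define q where "q = p - pcompose p [:-1, 1:]"
  have q_poly: "poly q x = poly p x - poly p (x - 1)" for x
    by (simp add: q_def poly_pcompose)
  have "numerical q"
    unfolding numerical_def
  proof
    fix k :: int
    show "poly q (of_int k) \<in> \<int>"
      using Suc.prems(1) unfolding numerical_def q_poly
      by (metis Ints_diff of_int_1 of_int_diff)
  qed
  moreover have "degree q \<le> n"
  proof -
    have dc: "degree (pcompose p [:-1, 1:]) = degree p" by (simp add: degree_pcompose)
    have "coeff q i = 0" if "i > n" for i
    proof (cases "i = degree p")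
      case True
      have "lead_coeff (pcompose p [:-1, 1:]) = lead_coeff p"
        by (subst lead_coeff_comp) auto
      then show ?thesis using True dc by (simp add: q_def)
    next
      case False
      then have "i > degree p" using that Suc.prems(2) by linarith
      then show ?thesis by (simp add: q_def coeff_eq_0 dc)
    qed
    then show ?thesis by (meson degree_le)
  qed
  ultimately obtain a where a: "q = (\<Sum>i\<le>n. smult (of_int (a i)) (binom_poly (int i) i))"
    using Suc.IH by blast
  define r where "r = (\<Sum>i\<le>n. smult (of_int (a i)) (binom_poly (int (Suc i)) (Suc i)))"
  have r_diff: "poly r x - poly r (x - 1) = poly q x" for x
  proof -
    have "(x + (1 + real i) gchoose Suc i) - (x + real i gchoose Suc i) = (x + real i gchoose i)" for i
      using gbinomial_Suc_Suc[of "x + real i" i] by (simp add: algebra_simps)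
    then show ?thesis
      unfolding r_def a
      by (simp add: poly_sum poly_binom_poly flip: sum_subtractf right_diff_distrib)
  qed
  have step: "poly (p - r) x = poly (p - r) (x - 1)" for x
    using r_diff[of x] q_poly[of x] by simp
  have "poly (p - r) (real k) = poly (p - r) 0" for k
  proof (induction k)
    case (Suc k)
    then show ?case using step[of "real (Suc k)"] by (simp del: poly_diff)
  qed simp
  then have "poly (p - r - [:poly (p - r) 0:]) (real k) = 0" for k by simp
  then have "range real \<subseteq> {x. poly (p - r - [:poly (p - r) 0:]) x = 0}" by blast
  moreover have "infinite (range real)"
    by (simp add: inj_on_def finite_image_iff)
  ultimately have zero: "p - r - [:poly (p - r) 0:] = 0"
    using poly_roots_finite finite_subset by blast
  have "poly r (of_int (-1)) = 0"
  proof -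
    have "(real i gchoose Suc i) = 0" for i
      by (simp flip: binomial_gbinomial)
    then show ?thesis by (simp add: r_def poly_sum poly_binom_poly)
  qed
  then have "poly (p - r) 0 = poly p (of_int (-1))"
    using step[of 0] by simp
  then have "poly (p - r) 0 \<in> \<int>"
    using Suc.prems(1) unfolding numerical_def by metis
  then obtain z where z: "poly (p - r) 0 = of_int z" by (auto elim: Ints_cases)
  have "p = r + [:of_int z:]" using zero z by (simp add: algebra_simps)
  also have "\<dots> = (\<Sum>i\<le>Suc n. smult (of_int (case i of 0 \<Rightarrow> z | Suc j \<Rightarrow> a j)) (binom_poly (int i) i))"
    by (simp add: r_def sum.atMost_Suc_shift binom_poly_0 del: sum.atMost_Suc)
  finally show ?case by blast
qed

lemma std_coeff_unique:
  assumes "numerical p"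
  shows "\<exists>!a. is_std_coeff p a"
proof -
  obtain a where a: "p = (\<Sum>i\<le>degree p. smult (of_int (a i)) (binom_poly (int i) i))"
    using numerical_binom_sum_exists[OF assms order_refl] by blast
  define b where "b i = (if i \<le> degree p then a i else 0)" for i
  have "is_std_coeff p b"
    using a by (simp add: is_std_coeff_def b_def)
  moreover have "c = b" if "is_std_coeff p c" for c
  proof
    fix i
    show "c i = b i"
      using \<open>is_std_coeff p b\<close> that binom_sum_inj[of c "degree p" b i]
      unfolding is_std_coeff_def by (metis not_le)
  qed
  ultimately show ?thesis by blast
qed

lemma is_std_coeff_std_coeff: "numerical p \<Longrightarrow> is_std_coeff p (std_coeff p)"
  unfolding std_coeff_def by (rule theI'[OF std_coeff_unique])

text \<open>The polynomial \<open>v\<close> by which the recursion for minimizing coefficients continues.\<close>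

definition min_step :: "real poly \<Rightarrow> real poly" where
  "min_step p =
     (let d = degree p; a = std_coeff p d
      in pcompose p [:of_int a, 1:] - binom_poly (int d + 1 + a) (d + 1) + binom_poly (int d + 1) (d + 1))"

lemma binom_poly_shift:
  "degree (binom_poly (k + a) (Suc n) - binom_poly k (Suc n)) \<le> n \<and>
   coeff (binom_poly (k + a) (Suc n) - binom_poly k (Suc n)) n = of_int a / fact n"
proof (induction a rule: int_induct[where k = 0])
  case base
  then show ?case by simp
next
  case (step1 i)
  have "binom_poly (k + (i + 1)) (Suc n) - binom_poly k (Suc n)
      = (binom_poly (k + i) (Suc n) - binom_poly k (Suc n)) + binom_poly (k + i) n"
    using binom_poly_Suc_diff[of "k + i" n] by (simp add: algebra_simps)
  moreover have "degree ((binom_poly (k + i) (Suc n) - binom_poly k (Suc n)) + binom_poly (k + i) n) \<le> n"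
    using step1 by (intro degree_add_le) (auto simp: degree_binom_poly)
  moreover have "coeff ((binom_poly (k + i) (Suc n) - binom_poly k (Suc n)) + binom_poly (k + i) n) n
      = of_int (i + 1) / fact n"
    using step1 by (simp add: lead_coeff_binom_poly add_divide_distrib)
  ultimately show ?case
    by (simp only: simp_thms)
next
  case (step2 i)
  have "binom_poly (k + (i - 1)) (Suc n) - binom_poly k (Suc n)
      = (binom_poly (k + i) (Suc n) - binom_poly k (Suc n)) - binom_poly (k + (i - 1)) n"
    using binom_poly_Suc_diff[of "k + (i - 1)" n] by (simp add: algebra_simps)
  moreover have "degree ((binom_poly (k + i) (Suc n) - binom_poly k (Suc n)) - binom_poly (k + (i - 1)) n) \<le> n"
    by (rule degree_diff_le) (use step2 in \<open>auto simp: degree_binom_poly\<close>)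
  moreover have "coeff ((binom_poly (k + i) (Suc n) - binom_poly k (Suc n)) - binom_poly (k + (i - 1)) n) n
      = of_int (i - 1) / fact n"
    using step2 by (simp add: lead_coeff_binom_poly diff_divide_distrib)
  ultimately show ?case
    by (simp only: simp_thms)
qed

lemma degree_min_step:
  assumes "numerical p" "degree p > 0"
  shows "degree (min_step p) < degree p"
proof -
  define d where "d = degree p"
  define a where "a = std_coeff p d"
  define D where "D = binom_poly (int d + 1 + a) (Suc d) - binom_poly (int d + 1) (Suc d)"
  have v: "min_step p = pcompose p [:of_int a, 1:] - D"
    by (simp add: min_step_def Let_def d_def a_def D_def)
  have D: "degree D \<le> d" "coeff D d = of_int a / fact d"
    using binom_poly_shift[of "int d + 1" a d] by (simp_all add: D_def)
  have "coeff p d = of_int a / fact d"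
    using is_std_coeff_std_coeff[OF assms(1)] coeff_binom_sum_top[of "std_coeff p" "degree p"]
    unfolding is_std_coeff_def d_def a_def by metis
  moreover have dc: "degree (pcompose p [:of_int a, 1:]) = d" by (simp add: d_def degree_pcompose)
  moreover have "lead_coeff (pcompose p [:of_int a, 1:]) = lead_coeff p"
    by (subst lead_coeff_comp) auto
  ultimately have top: "coeff (min_step p) d = 0"
    using D by (simp add: v d_def)
  have "degree (min_step p) \<le> d"
    unfolding v using D dc by (intro degree_diff_le) auto
  then show ?thesis
    using top assms(2) unfolding d_def
    by (metis coeff_0_degree_minus_1 degree_0 le_neq_implies_less leading_coeff_0_iff)
qed

lemma numerical_min_step:
  assumes "numerical p"
  shows "numerical (min_step p)"
proof -
  have gb: "(of_int k gchoose i :: real) \<in> \<int>" for k :: int and i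
  proof (cases "k \<ge> 0")
    case True
    then have "(of_int k gchoose i :: real) = of_nat (nat k choose i)"
      by (simp add: binomial_gbinomial)
    then show ?thesis by simp
  next
    case False
    then have "(of_int k gchoose i :: real) = (-1) ^ i * (of_nat (nat (int i - k - 1)) gchoose i)"
      by (subst gbinomial_negated_upper) simp
    also have "\<dots> = (-1) ^ i * of_nat (nat (int i - k - 1) choose i)"
      by (simp only: binomial_gbinomial)
    also have "\<dots> \<in> \<int>" by simp
    finally show ?thesis .
  qed
  have *: "poly (binom_poly k i) (of_int n) \<in> \<int>" for k n :: int and i
    using gb[of "n + k" i] by (simp add: poly_binom_poly)
  have "poly (pcompose p [:of_int a, 1:]) (of_int n) \<in> \<int>" for a n :: int
    using assms unfolding numerical_def
    by (simp add: poly_pcompose) (metis of_int_add)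
  then show ?thesis
    unfolding numerical_def min_step_def Let_def poly_add poly_diff
    by (intro allI Ints_add Ints_diff *)
qed

text \<open>\<open>min_coeffs p\<close> is the list \<open>[b\<^sub>d, \<dots>, b\<^sub>0]\<close> of minimizing coefficients of a
  numerical polynomial \<open>p\<close> of degree \<open>d\<close> (constants, including \<open>0\<close>, have degree \<open>0\<close>);
  the value \<open>[]\<close> on other polynomials is a dummy.\<close>

function min_coeffs :: "real poly \<Rightarrow> int list" where
  "min_coeffs p =
     (if \<not> numerical p then []
      else if degree p = 0 then [\<lfloor>coeff p 0\<rfloor>]
      else let bs = min_coeffs (min_step p)
           in std_coeff p (degree p) # replicate (degree p - length bs) 0 @ bs)"
  by auto
termination
  by (relation "measure degree") (auto intro: degree_min_step)

declare min_coeffs.simps [simp del]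

lemma length_min_coeffs: "numerical p \<Longrightarrow> length (min_coeffs p) = degree p + 1"
proof (induction p rule: min_coeffs.induct)
  case (1 p)
  show ?case
  proof (cases "degree p = 0")
    case True
    then show ?thesis using 1 by (subst min_coeffs.simps) simp
  next
    case False
    then have "length (min_coeffs (min_step p)) \<le> degree p"
      using 1 numerical_min_step[of p] degree_min_step[of p] by auto
    then show ?thesis using 1 False by (subst min_coeffs.simps) (simp add: Let_def)
  qed
qed

definition min_coeff :: "real poly \<Rightarrow> nat \<Rightarrow> int" where
  "min_coeff p j = min_coeffs p ! (degree p - j)"

definition macaulay_const :: "real poly \<Rightarrow> nat \<Rightarrow> int" where
  "macaulay_const p i = (\<Sum>j = i - 1..degree p. min_coeff p j)"

text \<open>The list \<open>[c\<^sub>d\<^sub>+\<^sub>1, c\<^sub>d, \<dots>, c\<^sub>1]\<close>.\<close>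

definition macaulay_seq :: "real poly \<Rightarrow> int list" where
  "macaulay_seq p = map (macaulay_const p) (rev [1..<degree p + 2])"

text \<open>Points of \<open>\<nat>\<^sup>m\<close> are lists of length \<open>m\<close>; \<open>list_all2 (\<le>)\<close> is the componentwise order.\<close>

definition kolchin_set :: "nat \<Rightarrow> nat list set \<Rightarrow> nat \<Rightarrow> nat list set" where
  "kolchin_set m E s =
     {x. length x = m \<and> sum_list x \<le> s \<and> \<not> (\<exists>e\<in>E. list_all2 (\<le>) e x)}"

lemma finite_kolchin_set: "finite (kolchin_set m E s)"
proof (rule finite_subset)
  show "kolchin_set m E s \<subseteq> {x. set x \<subseteq> {..s} \<and> length x = m}"
    by (auto simp: kolchin_set_def dest: member_le_sum_list)
  show "finite {x. set x \<subseteq> {..s} \<and> length x = m}"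
    by (rule finite_lists_length_eq) simp
qed

text \<open>\<open>p\<close> is the Kolchin dimension polynomial of the subset \<open>E\<close> of \<open>\<nat>\<^sup>m\<close>.\<close>

definition kolchin_poly_of :: "nat \<Rightarrow> nat list set \<Rightarrow> real poly \<Rightarrow> bool" where
  "kolchin_poly_of m E p \<longleftrightarrow>
     numerical p \<and>
     (\<forall>\<^sub>F s in sequentially. poly p (of_nat s) = of_nat (card (kolchin_set m E s)))"

lemma kolchin_poly_of_unique:
  assumes "kolchin_poly_of m E p" "kolchin_poly_of m E q"
  shows "p = q"
proof -
  have "\<forall>\<^sub>F s in sequentially. poly (p - q) (of_nat s) = 0"
    using assms unfolding kolchin_poly_of_def by (auto elim: eventually_elim2)
  then obtain N where N: "\<And>s. s \<ge> N \<Longrightarrow> poly (p - q) (of_nat s) = 0"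
    by (auto simp: eventually_sequentially)
  then have "real ` {N..} \<subseteq> {x. poly (p - q) x = 0}" by auto
  moreover have "infinite (real ` {N..})"
    by (simp add: finite_image_iff inj_on_def infinite_Ici)
  ultimately have "p - q = 0"
    using poly_roots_finite finite_subset by blast
  then show ?thesis by simp
qed

definition is_kolchin_poly :: "real poly \<Rightarrow> bool" where
  "is_kolchin_poly p \<longleftrightarrow> (\<exists>m\<ge>1. \<exists>E. E \<subseteq> {x. length x = m} \<and> kolchin_poly_of m E p)"

text \<open>The entries \<open>c\<^sub>d\<^sub>+\<^sub>1, \<dots>, c\<^sub>1\<close> being non-decreasing says \<open>b\<^sub>d\<^sub>-\<^sub>1, \<dots>, b\<^sub>0 \<ge> 0\<close>, but
  nothing about the first entry \<open>c\<^sub>d\<^sub>+\<^sub>1 = b\<^sub>d\<close>.  A Kolchin polynomial also needs \<open>c\<^sub>d\<^sub>+\<^sub>1 \<ge> 0\<close>:\<close>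

lemma sorted_macaulay_seq_not_kolchin:
  "numerical [:-1:]" "sorted (macaulay_seq [:-1:])" "\<not> is_kolchin_poly [:-1:]"
proof -
  show "numerical [:-1:]" by (simp add: numerical_def)
  show "sorted (macaulay_seq [:-1:])" by (simp add: macaulay_seq_def upt_rec)
  show "\<not> is_kolchin_poly [:-1:]"
  proof
    assume "is_kolchin_poly [:-1:]"
    then obtain m E where "\<forall>\<^sub>F s in sequentially. (-1::real) = of_nat (card (kolchin_set m E s))"
      by (auto simp: is_kolchin_poly_def kolchin_poly_of_def)
    then obtain s where "(-1::real) = of_nat (card (kolchin_set m E s))"
      by (auto simp: eventually_sequentially)
    then show False by (metis neg_0_le_iff_le not_one_le_zero of_nat_0_le_iff)
  qed
qed

end

theory Submission
  imports Defs "HOL-Library.Nat_Bijection"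
begin

text \<open>Consecutive Macaulay constants differ by a minimizing coefficient, and the first one is
\<open>b\<^sub>d\<close>.  The condition on the Macaulay constants therefore says that all minimizing
coefficients are non-negative (\<open>macaulay_const_nonneg_iff\<close>).

If they are non-negative, a suitable \<open>E\<close> is built along the recursion \<open>\<omega> \<mapsto> v\<close>.  In
\<open>d + 1\<close> variables, the points with first coordinate below \<open>a = a\<^sub>d\<close> are counted by
\<open>(s + d + 1 choose d + 1) - (s - a + d + 1 choose d + 1)\<close>.  If \<open>E'\<close> realises \<open>v\<close> in
these variables (surplus coordinates can be forced to be \<open>0\<close>), then translating \<open>E'\<close> by
\<open>a\<close> in the first coordinate keeps all those points and copies the set avoiding \<open>E'\<close> behind them, which adds \<open>v(s - a)\<close>.  By the definition of \<open>v\<close> the sum is \<open>\<omega>\<close>.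

Conversely, the points avoiding \<open>E\<close> form an order ideal \<open>V\<close>, that is, a set closed downwards
in the componentwise order.  It is enough to write the counting function of \<open>V\<close>, for large \<open>s\<close>, as
\<open>\<Sum>\<^sub>j (s - j + \<mu>\<^sub>j choose \<mu>\<^sub>j)\<close> with a finite non-increasing sequence \<open>\<mu>\<^sub>0 \<ge> \<mu>\<^sub>1 \<ge> \<dots>\<close>, the form
of a Hilbert polynomial due to Macaulay and Gotzmann: passing from \<open>\<omega>\<close> to \<open>v\<close> removes the
leading block of equal entries, whose length is the coefficient \<open>a\<^sub>d\<close>, so that every minimizing
coefficient is either \<open>0\<close> or the length of a block
(\<open>min_coeffs_macaulay_poly_nonneg\<close>).

To find \<open>\<mu>\<close>, first replace \<open>V\<close> by an order ideal with equally many points in each degree that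
is stable: it contains with a point every point obtained by moving a unit from a coordinate to
a later one.  This is the combinatorial counterpart of passing to a generic initial ideal.  It
is done by compressions in two coordinates, which push the points on each line
\<open>x\<^sub>i + x\<^sub>j = const\<close> together at one end (\<open>stable_order_ideal_exists\<close>).

For stable \<open>V\<close> in \<open>m + 1\<close> variables, argue by induction on \<open>m\<close> (\<open>stable_order_ideal_count\<close>).
Let \<open>U\<close> be the set of those points of \<open>\<nat>\<^sup>m\<close> over which the whole line in the last direction lies
in \<open>V\<close>.  The cylinder over \<open>U\<close> is counted by summing the counting function of \<open>U\<close> up to \<open>s\<close>, which
raises each entry of the sequence \<open>\<nu>\<close> of \<open>U\<close> by one, up to a constant.  The rest
\<open>X\<close> of \<open>V\<close> is finite, so it contributes a constant as well.  Both constants are non-negative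
and become zeros at the end of the sequence.  The induction also carries two bounds of Gotzmann type
in terms of the length \<open>l\<close> of the sequence: the counting function is nowhere below its
formula and agrees with it from \<open>l\<close> on, and the complement of the ideal is generated in degrees
at most \<open>l\<close>.  The last bound makes \<open>X\<close> finite and leaves no gaps in its degrees above \<open>l\<close>,
which is what re-establishes the bounds for \<open>V\<close>.\<close>

section \<open>Order ideals of monomials\<close>

text \<open>A point of \<open>\<nat>\<^sup>m\<close> is represented by a function that vanishes from \<open>m\<close> on.  Then
\<open>\<nat>\<^sup>m\<close> is contained in \<open>\<nat>\<^sup>m\<^sup>+\<^sup>1\<close>, and changing a coordinate is a function update.\<close>

definition monomials :: "nat \<Rightarrow> (nat \<Rightarrow> nat) set" where
  "monomials m = {x. \<forall>i\<ge>m. x i = 0}"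

definition mdeg :: "nat \<Rightarrow> (nat \<Rightarrow> nat) \<Rightarrow> nat" where
  "mdeg m x = (\<Sum>i<m. x i)"

definition order_ideal :: "nat \<Rightarrow> (nat \<Rightarrow> nat) set \<Rightarrow> bool" where
  "order_ideal m V \<longleftrightarrow> V \<subseteq> monomials m \<and> (\<forall>x\<in>V. \<forall>y\<le>x. y \<in> V)"

definition layer :: "nat \<Rightarrow> (nat \<Rightarrow> nat) set \<Rightarrow> nat \<Rightarrow> (nat \<Rightarrow> nat) set" where
  "layer m V t = {x \<in> V. mdeg m x = t}"

definition up_to_degree :: "nat \<Rightarrow> (nat \<Rightarrow> nat) set \<Rightarrow> nat \<Rightarrow> (nat \<Rightarrow> nat) set" where
  "up_to_degree m V t = {x \<in> V. mdeg m x \<le> t}"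

lemma order_idealD: "order_ideal m V \<Longrightarrow> x \<in> V \<Longrightarrow> y \<le> x \<Longrightarrow> y \<in> V"
  by (auto simp: order_ideal_def)

lemma order_ideal_monomials: "order_ideal m V \<Longrightarrow> x \<in> V \<Longrightarrow> x \<in> monomials m"
  by (auto simp: order_ideal_def)

lemma mdeg_upd: "i < m \<Longrightarrow> mdeg m (x(i := a)) + x i = mdeg m x + a"
  by (simp add: mdeg_def sum.remove[of "{..<m}" i])

lemma mdeg_upd_ge: "m \<le> i \<Longrightarrow> mdeg m (x(i := a)) = mdeg m x"
  by (auto simp: mdeg_def intro!: sum.cong)

lemma monomials_upd: "i < m \<Longrightarrow> x(i := a) \<in> monomials m \<longleftrightarrow> x \<in> monomials m"
  by (auto simp: monomials_def)

lemma finite_up_to_degree: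
  assumes "V \<subseteq> monomials m"
  shows "finite (up_to_degree m V t)"
proof (rule finite_subset)
  show "up_to_degree m V t \<subseteq> {f. \<forall>i. (i \<in> {..<m} \<longrightarrow> f i \<in> {..t}) \<and> (i \<notin> {..<m} \<longrightarrow> f i = 0)}"
  proof (clarsimp, intro conjI impI)
    fix x i assume x: "x \<in> up_to_degree m V t"
    show "x i \<le> t" if "i < m"
      using x member_le_sum[of i "{..<m}" x] that by (simp add: up_to_degree_def mdeg_def)
    show "x i = 0" if "\<not> i < m"
      using x that assms by (auto simp: up_to_degree_def monomials_def)
  qed
  show "finite {f. \<forall>i. (i \<in> {..<m} \<longrightarrow> f i \<in> {..t}) \<and> (i \<notin> {..<m} \<longrightarrow> f i = (0::nat))}"
    by (rule finite_set_of_finite_funs) auto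
qed

lemma finite_layer: "V \<subseteq> monomials m \<Longrightarrow> finite (layer m V t)"
  by (rule finite_subset[OF _ finite_up_to_degree[of V m t]]) (auto simp: layer_def up_to_degree_def)

lemma up_to_degree_eq_Union_layer: "up_to_degree m V s = (\<Union>t\<le>s. layer m V t)"
  by (auto simp: up_to_degree_def layer_def)

lemma card_up_to_degree_eq_sum_layer:
  assumes "V \<subseteq> monomials m"
  shows "card (up_to_degree m V s) = (\<Sum>t\<le>s. card (layer m V t))"
  unfolding up_to_degree_eq_Union_layer
  by (rule card_UN_disjoint) (auto simp: finite_layer assms, auto simp: layer_def)

section \<open>Compression in two coordinates\<close>

text \<open>The points of \<open>V\<close> that differ from \<open>z\<close> in the coordinates \<open>i\<close> and \<open>j\<close> only, and for which these two
add up to \<open>n\<close>, recorded by their \<open>i\<close>-th coordinate.\<close>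

definition fibre :: "(nat \<Rightarrow> nat) set \<Rightarrow> nat \<Rightarrow> nat \<Rightarrow> (nat \<Rightarrow> nat) \<Rightarrow> nat \<Rightarrow> nat set" where
  "fibre V i j z n = {a. a \<le> n \<and> z(i := a, j := n - a) \<in> V}"

text \<open>Each fibre of \<open>V\<close> is replaced by an initial segment of the same size.\<close>

definition compress :: "nat \<Rightarrow> nat \<Rightarrow> nat \<Rightarrow> (nat \<Rightarrow> nat) set \<Rightarrow> (nat \<Rightarrow> nat) set" where
  "compress m i j V = {x \<in> monomials m. x i < card (fibre V i j x (x i + x j))}"

lemma fibre_subset: "fibre V i j z n \<subseteq> {..n}"
  by (auto simp: fibre_def)

lemma finite_fibre: "finite (fibre V i j z n)"
  by (rule finite_subset[OF fibre_subset]) simp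

lemma card_fibre_le: "card (fibre V i j z n) \<le> Suc n"
  using card_mono[OF _ fibre_subset] by fastforce

lemma fibre_upd: "i \<noteq> j \<Longrightarrow> fibre V i j (z(i := a, j := b)) n = fibre V i j z n"
  by (simp add: fibre_def fun_upd_twist)

lemma fibre_antimono:
  assumes "order_ideal m V" "y \<le> z"
  shows "fibre V i j z n \<subseteq> fibre V i j y n"
proof
  fix a assume a: "a \<in> fibre V i j z n"
  have "y(i := a, j := n - a) \<le> z(i := a, j := n - a)"
    using assms(2) by (auto simp: le_fun_def)
  then show "a \<in> fibre V i j y n"
    using a assms(1) by (auto simp: fibre_def intro: order_idealD)
qed

text \<open>An order ideal in two variables with a missing point on the line of degree \<open>n + 1\<close> has at least as
many points on the line of degree \<open>n\<close>: decrease the first coordinate of the points beyond the gap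
and the second coordinate of those before it.  If no point is missing, all \<open>n + 1\<close> points of
degree \<open>n\<close> are present.  This growth condition is what keeps compressed sets downward closed.\<close>

lemma card_fibre_Suc:
  assumes V: "order_ideal m V" and ij: "i \<noteq> j"
  shows "min (card (fibre V i j z (Suc n))) (Suc n) \<le> card (fibre V i j z n)"
proof (cases "{..Suc n} \<subseteq> fibre V i j z (Suc n)")
  case True
  have "{..n} \<subseteq> fibre V i j z n"
  proof
    fix a assume a: "a \<in> {..n}"
    have "z(i := a, j := n - a) \<le> z(i := a, j := Suc n - a)"
      using a by (auto simp: le_fun_def)
    moreover have "a \<in> fibre V i j z (Suc n)" by (rule subsetD[OF True]) (use a in simp)
    then have "z(i := a, j := Suc n - a) \<in> V" by (simp add: fibre_def)
    ultimately have "z(i := a, j := n - a) \<in> V" by (rule order_idealD[OF V, rotated])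
    then show "a \<in> fibre V i j z n"
      using a by (auto simp: fibre_def)
  qed
  from card_mono[OF finite_fibre this] show ?thesis by simp
next
  case False
  then obtain c where c: "c \<le> Suc n" "c \<notin> fibre V i j z (Suc n)" by auto
  define f where "f a = (if a < c then a else a - 1)" for a
  have "f ` fibre V i j z (Suc n) \<subseteq> fibre V i j z n"
  proof clarify
    fix a assume a: "a \<in> fibre V i j z (Suc n)"
    then have "a \<noteq> c" using c by auto
    moreover have "z(i := f a, j := n - f a) \<le> z(i := a, j := Suc n - a)"
      using a ij \<open>a \<noteq> c\<close> c by (auto simp: le_fun_def f_def fibre_def)
    ultimately show "f a \<in> fibre V i j z n"
      using a c V by (auto simp: fibre_def f_def intro: order_idealD)
  qed
  moreover have "inj_on f (fibre V i j z (Suc n))"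
  proof (rule inj_onI)
    fix a b assume "a \<in> fibre V i j z (Suc n)" "b \<in> fibre V i j z (Suc n)" "f a = f b"
    moreover from this have "a \<noteq> c" "b \<noteq> c" using c by auto
    ultimately show "a = b" unfolding f_def by (simp split: if_splits)
  qed
  ultimately have "card (fibre V i j z (Suc n)) \<le> card (fibre V i j z n)"
    by (metis card_image card_mono finite_fibre)
  then show ?thesis by simp
qed

lemma card_fibre_le_smaller:
  assumes "order_ideal m V" "i \<noteq> j" "k \<le> n"
  shows "min (card (fibre V i j z n)) (Suc k) \<le> card (fibre V i j z k)"
  using assms(3)
proof (induction n rule: dec_induct)
  case base
  show ?case by simp
next
  case (step n)
  then show ?case using card_fibre_Suc[OF assms(1,2), of z n] by linarith
qed

lemma order_ideal_compress:
  assumes V: "order_ideal m V" and ij: "i \<noteq> j"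
  shows "order_ideal m (compress m i j V)"
  unfolding order_ideal_def
proof (intro conjI ballI allI impI)
  show "compress m i j V \<subseteq> monomials m" by (auto simp: compress_def)
next
  fix x y assume x: "x \<in> compress m i j V" and y: "y \<le> x"
  have le: "y l \<le> x l" for l using y by (simp add: le_fun_def)
  have "y \<in> monomials m"
    using x le by (auto simp: compress_def monomials_def) (metis le_zero_eq)
  moreover have "y i < card (fibre V i j y (y i + y j))"
  proof -
    have "y i < min (card (fibre V i j x (x i + x j))) (Suc (y i + y j))"
      using x le[of i] by (auto simp: compress_def)
    also have "\<dots> \<le> card (fibre V i j x (y i + y j))"
      by (rule card_fibre_le_smaller[OF V ij]) (simp add: add_mono le)
    also have "\<dots> \<le> card (fibre V i j y (y i + y j))"
      by (rule card_mono[OF finite_fibre fibre_antimono[OF V y]])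
    finally show ?thesis .
  qed
  ultimately show "y \<in> compress m i j V" by (simp add: compress_def)
qed

lemma fibre_compress:
  assumes "i < m" "j < m" "i \<noteq> j" "z \<in> monomials m"
  shows "fibre (compress m i j V) i j z n = {..<card (fibre V i j z n)}"
proof -
  have "z(i := a, j := n - a) \<in> compress m i j V \<longleftrightarrow> a < card (fibre V i j z n)" if "a \<le> n" for a
    using that assms by (simp add: compress_def monomials_upd fibre_upd)
  then show ?thesis
    using card_fibre_le[of V i j z n] by (auto simp: fibre_def[of "compress m i j V"])
qed

text \<open>The layer of degree \<open>t\<close> is partitioned into fibres.  Each fibre is represented by its point \<open>z\<close>
with \<open>i\<close>-th coordinate \<open>0\<close>, for which the sum of both coordinates is \<open>z j\<close>.\<close>

lemma sum_layer_fibres: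
  assumes "i < m" "j < m" "i \<noteq> j" "V \<subseteq> monomials m"
  shows "(\<Sum>x\<in>layer m V t. h x) =
    (\<Sum>z | z \<in> layer m (monomials m) t \<and> z i = 0. \<Sum>a\<in>fibre V i j z (z j). h (z(i := a, j := z j - a)))"
proof -
  let ?T = "{z. z \<in> layer m (monomials m) t \<and> z i = 0}"
  have fin: "finite ?T"
    by (rule finite_subset[OF _ finite_layer[of "monomials m" m t]]) auto
  have deg: "mdeg m (x(i := a, j := b)) + x i + x j = mdeg m x + a + b" for x a b
    using mdeg_upd[OF assms(1), of x a] mdeg_upd[OF assms(2), of "x(i := a)" b] assms(3) by simp
  have "(\<Sum>z\<in>?T. \<Sum>a\<in>fibre V i j z (z j). h (z(i := a, j := z j - a)))
      = (\<Sum>(z, a)\<in>Sigma ?T (\<lambda>z. fibre V i j z (z j)). h (z(i := a, j := z j - a)))"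
    by (rule sum.Sigma) (use fin finite_fibre in auto)
  also have "\<dots> = (\<Sum>x\<in>layer m V t. h x)"
  proof (rule sum.reindex_bij_witness[where
        i = "\<lambda>x. (x(i := 0, j := x i + x j), x i)" and j = "\<lambda>(z, a). z(i := a, j := z j - a)"])
    fix x assume x: "x \<in> layer m V t"
    have "x(i := x i, j := x j) = x" by simp
    show "(case (x(i := 0, j := x i + x j), x i) of (z, a) \<Rightarrow> z(i := a, j := z j - a)) = x"
      using assms(3) by (auto simp: fun_eq_iff)
    show "(x(i := 0, j := x i + x j), x i) \<in> Sigma ?T (\<lambda>z. fibre V i j z (z j))"
      using x assms deg[of x 0 "x i + x j"]
      by (auto simp: layer_def monomials_upd fibre_def fun_upd_twist)
  next
    fix q assume q: "q \<in> Sigma ?T (\<lambda>z. fibre V i j z (z j))"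
    obtain z a where [simp]: "q = (z, a)" by fastforce
    have za: "z i = 0" "a \<le> z j" "z(i := a, j := z j - a) \<in> V" "mdeg m z = t"
      using q by (auto simp: fibre_def layer_def)
    let ?x = "z(i := a, j := z j - a)"
    have "?x i = a" "?x i + ?x j = z j" using assms(3) za by auto
    then show "((case q of (z, a) \<Rightarrow> z(i := a, j := z j - a))
          (i := 0, j := (case q of (z, a) \<Rightarrow> z(i := a, j := z j - a)) i +
             (case q of (z, a) \<Rightarrow> z(i := a, j := z j - a)) j),
         (case q of (z, a) \<Rightarrow> z(i := a, j := z j - a)) i) = q"
      using assms(3) za by (auto simp: fun_eq_iff)
    show "(case q of (z, a) \<Rightarrow> z(i := a, j := z j - a)) \<in> layer m V t"
      using za deg[of z a "z j - a"] by (simp add: layer_def)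
    show "h (case q of (z, a) \<Rightarrow> z(i := a, j := z j - a)) =
       (case q of (z, a) \<Rightarrow> h (z(i := a, j := z j - a)))" by simp
  qed
  finally show ?thesis by simp
qed

lemma card_layer_compress:
  assumes "i < m" "j < m" "i \<noteq> j" "V \<subseteq> monomials m"
  shows "card (layer m (compress m i j V) t) = card (layer m V t)"
proof -
  let ?T = "{z. z \<in> layer m (monomials m) t \<and> z i = 0}"
  have "compress m i j V \<subseteq> monomials m" by (auto simp: compress_def)
  then have "card (layer m (compress m i j V) t) = (\<Sum>z\<in>?T. card (fibre (compress m i j V) i j z (z j)))"
    using sum_layer_fibres[OF assms(1-3), of "compress m i j V" "\<lambda>_. 1 :: nat" t] by simp
  also have "\<dots> = (\<Sum>z\<in>?T. card (fibre V i j z (z j)))"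
    using assms by (intro sum.cong) (auto simp: fibre_compress layer_def)
  also have "\<dots> = card (layer m V t)"
    using sum_layer_fibres[OF assms, of "\<lambda>_. 1 :: nat" t] by simp
  finally show ?thesis .
qed

text \<open>A potential: moving a unit to a later coordinate decreases it, so a compression with \<open>i < j\<close> lowers
its sum over a layer unless it leaves that layer unchanged.\<close>

definition weight :: "nat \<Rightarrow> (nat \<Rightarrow> nat) \<Rightarrow> nat" where
  "weight m x = (\<Sum>l<m. (m - l) * x l)"

lemma weight_upd: "i < m \<Longrightarrow> weight m (x(i := a)) + (m - i) * x i = weight m x + (m - i) * a"
  by (simp add: weight_def sum.remove[of "{..<m}" i])

lemma weight_move:
  assumes "i < j" "j < m" "z i = 0" "a \<le> z j"
  shows "weight m (z(i := a, j := z j - a)) = weight m z + (j - i) * a"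
proof -
  have "weight m (z(i := a, j := z j - a)) + (m - j) * z j = weight m z + (m - i) * a + (m - j) * (z j - a)"
    using weight_upd[of i m z a] weight_upd[of j m "z(i := a)" "z j - a"] assms by simp
  moreover have "(m - j) * z j = (m - j) * (z j - a) + (m - j) * a"
    using assms by (metis add_mult_distrib2 le_add_diff_inverse2)
  moreover have "(m - i) * a = (m - j) * a + (j - i) * a"
    using assms by (simp flip: add_mult_distrib)
  ultimately show ?thesis by linarith
qed

lemma sum_lessThan_card_le:
  fixes A :: "nat set"
  assumes "finite A"
  shows "\<Sum>{..<card A} \<le> \<Sum>A" and "A \<noteq> {..<card A} \<Longrightarrow> \<Sum>{..<card A} < \<Sum>A"
proof -
  let ?B = "{..<card A}"
  \<comment> \<open>\<open>A\<close> arises from the initial segment by exchanging elements below \<open>card A\<close> for as many elements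
    that are at least \<open>card A\<close>.\<close>
  have c: "card (A - ?B) = card (?B - A)"
    using card_Diff_subset_Int[of A ?B] card_Diff_subset_Int[of ?B A] assms
    by (simp add: Int_commute)
  have 1: "card A * card (A - ?B) \<le> \<Sum>(A - ?B)"
    using sum_bounded_below[of "A - ?B" "card A" "\<lambda>x. x"] by (simp add: mult.commute)
  have 2: "\<Sum>(?B - A) + card (?B - A) \<le> card A * card (?B - A)"
  proof -
    have "(\<Sum>x\<in>?B - A. x + 1) \<le> card (?B - A) * card A"
      using sum_bounded_above[of "?B - A" "\<lambda>x. x + 1" "card A"] by auto
    then show ?thesis by (simp add: sum_Suc mult.commute)
  qed
  have 3: "\<Sum>A = \<Sum>(A - ?B) + \<Sum>(A \<inter> ?B)" "\<Sum>?B = \<Sum>(?B - A) + \<Sum>(A \<inter> ?B)"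
    using sum.Int_Diff[of A "\<lambda>x. x" ?B] sum.Int_Diff[of ?B "\<lambda>x. x" A] assms
    by (simp_all add: Int_commute)
  show "\<Sum>?B \<le> \<Sum>A" using 1 2 3 c by simp
  assume "A \<noteq> ?B"
  then have "A - ?B \<noteq> {}"
    using card_subset_eq[of ?B A] by auto
  then have "card (A - ?B) > 0" using assms by (simp add: card_gt_0_iff)
  then show "\<Sum>?B < \<Sum>A" using 1 2 3 unfolding c by linarith
qed

lemma weight_compress:
  assumes ij: "i < j" "j < m" and V: "V \<subseteq> monomials m"
  defines "W \<equiv> compress m i j V"
  shows "(\<Sum>x\<in>layer m W t. weight m x) \<le> (\<Sum>x\<in>layer m V t. weight m x)" (is ?le)
    and "layer m W t \<noteq> layer m V t \<Longrightarrow>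
      (\<Sum>x\<in>layer m W t. weight m x) < (\<Sum>x\<in>layer m V t. weight m x)"
proof -
  let ?T = "{z. z \<in> layer m (monomials m) t \<and> z i = 0}"
  have fin: "finite ?T"
    by (rule finite_subset[OF _ finite_layer[of "monomials m" m t]]) auto
  have W: "W \<subseteq> monomials m" by (auto simp: W_def compress_def)
  have wt: "(\<Sum>x\<in>layer m Q t. weight m x)
      = (\<Sum>z\<in>?T. card (fibre Q i j z (z j)) * weight m z + (j - i) * \<Sum>(fibre Q i j z (z j)))"
    if "Q \<subseteq> monomials m" for Q
  proof -
    have "(\<Sum>x\<in>layer m Q t. weight m x)
       = (\<Sum>z\<in>?T. \<Sum>a\<in>fibre Q i j z (z j). weight m z + (j - i) * a)"
      using ij that
      by (subst sum_layer_fibres[of i m j]) (auto intro!: sum.cong simp: weight_move fibre_def)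
    then show ?thesis by (simp add: sum.distrib sum_distrib_left)
  qed
  have fW: "fibre W i j z (z j) = {..<card (fibre V i j z (z j))}" if "z \<in> ?T" for z
    unfolding W_def using that ij by (intro fibre_compress) (auto simp: layer_def)
  have le: "card (fibre W i j z (z j)) * weight m z + (j - i) * \<Sum>(fibre W i j z (z j))
      \<le> card (fibre V i j z (z j)) * weight m z + (j - i) * \<Sum>(fibre V i j z (z j))" if "z \<in> ?T" for z
    using sum_lessThan_card_le(1)[OF finite_fibre[of V i j z "z j"]] by (simp add: fW[OF that])
  show ?le
    unfolding wt[OF V] wt[OF W] by (rule sum_mono) (rule le)
  assume ne: "layer m W t \<noteq> layer m V t"
  have "\<exists>z\<in>?T. fibre W i j z (z j) \<noteq> fibre V i j z (z j)"
  proof (rule ccontr)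
    assume "\<not> ?thesis"
    then have eq: "fibre W i j z (z j) = fibre V i j z (z j)" if "z \<in> ?T" for z using that by blast
    have "x \<in> W \<longleftrightarrow> x \<in> V" if "x \<in> monomials m" "mdeg m x = t" for x
    proof -
      let ?z = "x(i := 0, j := x i + x j)"
      have "?z \<in> ?T"
        using that ij mdeg_upd[of i m x 0] mdeg_upd[of j m "x(i := 0)" "x i + x j"]
        by (auto simp: layer_def monomials_upd)
      moreover have "x \<in> Q \<longleftrightarrow> x i \<in> fibre Q i j ?z (?z j)" for Q
        using ij by (simp add: fibre_def fun_upd_twist)
      ultimately show ?thesis using eq by blast
    qed
    then have "layer m W t = layer m V t"
      using V W by (auto simp: layer_def)
    then show False using ne by simp
  qed
  then obtain z where z: "z \<in> ?T" "fibre W i j z (z j) \<noteq> fibre V i j z (z j)" by blast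
  have "\<Sum>{..<card (fibre V i j z (z j))} < \<Sum>(fibre V i j z (z j))"
    using z fW[OF z(1)] finite_fibre by (intro sum_lessThan_card_le(2)) auto
  then have "card (fibre W i j z (z j)) * weight m z + (j - i) * \<Sum>(fibre W i j z (z j))
      < card (fibre V i j z (z j)) * weight m z + (j - i) * \<Sum>(fibre V i j z (z j))"
    using ij by (simp add: fW[OF z(1)])
  then show "(\<Sum>x\<in>layer m W t. weight m x) < (\<Sum>x\<in>layer m V t. weight m x)"
    unfolding wt[OF V] wt[OF W] using le z(1) fin by (intro sum_strict_mono_ex1) auto
qed

section \<open>Stable order ideals\<close>

text \<open>The order-ideal version of strong stability (the Borel-fixed property) of a monomial ideal.\<close>

definition stable :: "nat \<Rightarrow> (nat \<Rightarrow> nat) set \<Rightarrow> bool" where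
  "stable m V \<longleftrightarrow>
     (\<forall>x\<in>V. \<forall>i j. i < j \<longrightarrow> j < m \<longrightarrow> 0 < x i \<longrightarrow> x(i := x i - 1, j := Suc (x j)) \<in> V)"

text \<open>Decoding twice makes every pair \<open>(i, j)\<close> occur at infinitely many stages.\<close>

fun iterated_compress :: "nat \<Rightarrow> (nat \<Rightarrow> nat) set \<Rightarrow> nat \<Rightarrow> (nat \<Rightarrow> nat) set" where
  "iterated_compress m V 0 = V"
| "iterated_compress m V (Suc n) =
    (let (i, j) = prod_decode (fst (prod_decode n))
     in if i < j \<and> j < m then compress m i j (iterated_compress m V n)
        else iterated_compress m V n)"

lemma order_ideal_iterated_compress:
  "order_ideal m V \<Longrightarrow> order_ideal m (iterated_compress m V n)"
  by (induction n) (auto simp: order_ideal_compress split: prod.split)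

lemma card_layer_iterated_compress:
  assumes "order_ideal m V"
  shows "card (layer m (iterated_compress m V n) t) = card (layer m V t)"
proof (induction n)
  case (Suc n)
  have "iterated_compress m V n \<subseteq> monomials m"
    using order_ideal_iterated_compress[OF assms] by (simp add: order_ideal_def)
  then show ?case using Suc by (auto simp: card_layer_compress split: prod.split)
qed simp

lemma iterated_compress_eventually_constant:
  assumes V: "order_ideal m V"
  shows "\<exists>N. \<forall>n\<ge>N. layer m (iterated_compress m V n) t = layer m (iterated_compress m V N) t"
proof -
  let ?V = "iterated_compress m V"
  define \<Phi> where "\<Phi> n = (\<Sum>x\<in>layer m (?V n) t. weight m x)" for n
  have sub: "?V n \<subseteq> monomials m" for n
    using order_ideal_iterated_compress[OF V] by (simp add: order_ideal_def)
  have dec: "\<Phi> (Suc n) \<le> \<Phi> n" "layer m (?V (Suc n)) t \<noteq> layer m (?V n) t \<Longrightarrow> \<Phi> (Suc n) < \<Phi> n" for n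
  proof -
    obtain i j where ij: "prod_decode (fst (prod_decode n)) = (i, j)" by fastforce
    then have eq: "?V (Suc n) = (if i < j \<and> j < m then compress m i j (?V n) else ?V n)" by simp
    have "\<Phi> (Suc n) \<le> \<Phi> n \<and> (layer m (?V (Suc n)) t \<noteq> layer m (?V n) t \<longrightarrow> \<Phi> (Suc n) < \<Phi> n)"
    proof (cases "i < j \<and> j < m")
      case True
      have e: "?V (Suc n) = compress m i j (?V n)" using eq unfolding if_P[OF True] .
      show ?thesis
        unfolding \<Phi>_def e using weight_compress[OF conjunct1[OF True] conjunct2[OF True] sub] by blast
    next
      case False
      have e: "?V (Suc n) = ?V n" using eq unfolding if_not_P[OF False] .
      show ?thesis unfolding \<Phi>_def e by blast
    qed
    then show "\<Phi> (Suc n) \<le> \<Phi> n"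
      and "layer m (?V (Suc n)) t \<noteq> layer m (?V n) t \<Longrightarrow> \<Phi> (Suc n) < \<Phi> n" by blast+
  qed
  \<comment> \<open>From a stage with minimal potential on, no compression can change the layer.\<close>
  obtain N where N: "\<And>n. \<Phi> N \<le> \<Phi> n" using ex_has_least_nat[of "\<lambda>_. True" 0 \<Phi>] by auto
  have "\<Phi> n = \<Phi> N \<and> layer m (?V n) t = layer m (?V N) t" if "n \<ge> N" for n
    using that
  proof (induction n rule: dec_induct)
    case (step n)
    then show ?case using dec[of n] N[of "Suc n"] by (metis le_antisym leD)
  qed simp
  then show ?thesis by blast
qed

text \<open>The compressed ideals become constant in each degree, though not uniformly in the
degree, so the stable ideal is their limit: the set of points that belong to all late stages.  In a
given degree it coincides with a late stage that any prescribed compression leaves unchanged.\<close>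

lemma stable_order_ideal_exists:
  assumes V: "order_ideal m V"
  shows "\<exists>W. order_ideal m W \<and> stable m W \<and> (\<forall>t. card (layer m W t) = card (layer m V t))"
proof -
  let ?V = "iterated_compress m V"
  define W where "W = {x. \<exists>N. \<forall>n\<ge>N. x \<in> ?V n}"
  have "\<forall>t. \<exists>N. \<forall>n\<ge>N. layer m (?V n) t = layer m (?V N) t"
    using iterated_compress_eventually_constant[OF V] by blast
  then obtain N where N: "\<And>t n. n \<ge> N t \<Longrightarrow> layer m (?V n) t = layer m (?V (N t)) t"
    by metis
  have W: "layer m W t = layer m (?V n) t" if "n \<ge> N t" for n t
  proof -
    have "x \<in> W \<longleftrightarrow> x \<in> ?V n" if "mdeg m x = t" for x
    proof -
      have *: "x \<in> ?V k \<longleftrightarrow> x \<in> ?V n" if "k \<ge> N t" for k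
        using N[OF that] N[OF \<open>n \<ge> N t\<close>] \<open>mdeg m x = t\<close> by (auto simp: layer_def)
      show ?thesis
      proof
        assume "x \<in> W"
        then obtain M where "\<forall>k\<ge>M. x \<in> ?V k" by (auto simp: W_def)
        then show "x \<in> ?V n" using *[of "max M (N t)"] by simp
      qed (use * in \<open>auto simp: W_def\<close>)
    qed
    then show ?thesis by (auto simp: layer_def)
  qed
  have oi: "order_ideal m W"
    using order_ideal_iterated_compress[OF V]
    unfolding order_ideal_def W_def by blast
  have "stable m W"
    unfolding stable_def
  proof (intro ballI allI impI)
    fix x i j assume x: "x \<in> W" and ij: "i < j" "j < m" and pos: "0 < x i"
    define t where "t = mdeg m x"
    \<comment> \<open>A stage after stabilisation in degree \<open>t\<close> at which the pair \<open>(i, j)\<close> is compressed.\<close>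
    define n where "n = prod_encode (prod_encode (i, j), N t)"
    have n: "n \<ge> N t" by (simp add: n_def le_prod_encode_2)
    have step: "?V (Suc n) = compress m i j (?V n)" using ij by (simp add: n_def)
    have "x \<in> layer m W t" using x by (simp add: t_def layer_def)
    then have "x \<in> layer m (?V (Suc n)) t" using W[of t "Suc n"] n by (simp del: iterated_compress.simps)
    then have "x \<in> ?V (Suc n)" by (simp add: layer_def del: iterated_compress.simps)
    then have xc: "x \<in> monomials m" "x i < card (fibre (?V n) i j x (x i + x j))"
      unfolding step compress_def by simp_all
    let ?y = "x(i := x i - 1, j := Suc (x j))"
    have "?y \<in> ?V (Suc n)"
      unfolding step compress_def using xc ij pos by (simp add: monomials_upd fibre_upd)
    moreover have "mdeg m ?y = t"
      using mdeg_upd[of i m x "x i - 1"] mdeg_upd[of j m "x(i := x i - 1)" "Suc (x j)"] ij pos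
      by (simp add: t_def)
    ultimately have "?y \<in> layer m (?V (Suc n)) t" by (simp add: layer_def del: iterated_compress.simps)
    then have "?y \<in> layer m W t" using W[of t "Suc n"] n by (simp del: iterated_compress.simps)
    then show "?y \<in> W" by (simp add: layer_def)
  qed
  then show ?thesis
    using oi W card_layer_iterated_compress[OF V] by (metis order_refl)
qed

section \<open>Macaulay sums\<close>

text \<open>The sequence \<open>\<mu>\<close> stands for \<open>\<Sum>\<^sub>j (t - j + \<mu>\<^sub>j choose \<mu>\<^sub>j)\<close>.  Terms with \<open>t < j\<close> are
dropped, so that summation over \<open>t\<close> raises each entry by one with no error term.\<close>

definition macaulay_sum :: "nat list \<Rightarrow> nat \<Rightarrow> nat" where
  "macaulay_sum \<mu> t = (\<Sum>j<length \<mu>. if j \<le> t then (t - j + \<mu> ! j) choose (\<mu> ! j) else 0)"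

lemma macaulay_sum_snoc:
  "macaulay_sum (\<mu> @ [k]) t =
     macaulay_sum \<mu> t + (if length \<mu> \<le> t then (t - length \<mu> + k) choose k else 0)"
proof -
  have "(\<Sum>j<length \<mu>. if j \<le> t then (t - j + (\<mu> @ [k]) ! j) choose ((\<mu> @ [k]) ! j) else 0)
      = macaulay_sum \<mu> t"
    unfolding macaulay_sum_def by (rule sum.cong) (auto simp: nth_append)
  then show ?thesis by (simp add: macaulay_sum_def)
qed

text \<open>A trailing zero contributes \<open>1\<close> from its position on.\<close>

lemma macaulay_sum_append_zeros:
  "macaulay_sum (\<mu> @ replicate c 0) t = macaulay_sum \<mu> t + min c (t + 1 - length \<mu>)"
proof (induction c)
  case (Suc c)
  have "\<mu> @ replicate (Suc c) 0 = (\<mu> @ replicate c 0) @ [0]"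
    by (simp add: replicate_append_same)
  then have "macaulay_sum (\<mu> @ replicate (Suc c) 0) t
      = macaulay_sum (\<mu> @ replicate c 0) t + (if length \<mu> + c \<le> t then 1 else 0)"
    by (simp only: macaulay_sum_snoc) simp
  then show ?case using Suc by auto
qed simp

lemma sum_shifted_binomials:
  "(\<Sum>t\<le>s. if j \<le> t then (t - j + k) choose k else 0)
     = (if j \<le> s then (s - j + Suc k) choose Suc k else (0::nat))"
proof (induction s)
  case (Suc s)
  show ?case
  proof (cases "j \<le> s")
    case True
    then have "Suc s - j = Suc (s - j)" by simp
    then show ?thesis using Suc True by (simp del: binomial_Suc_Suc) (simp)
  qed (use Suc in auto)
qed auto

lemma macaulay_sum_map_Suc: "macaulay_sum (map Suc \<mu>) s = (\<Sum>t\<le>s. macaulay_sum \<mu> t)"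
proof -
  have "(\<Sum>t\<le>s. macaulay_sum \<mu> t)
      = (\<Sum>j<length \<mu>. \<Sum>t\<le>s. if j \<le> t then (t - j + \<mu> ! j) choose (\<mu> ! j) else 0)"
    unfolding macaulay_sum_def by (rule sum.swap)
  then show ?thesis
    unfolding sum_shifted_binomials unfolding macaulay_sum_def by (auto intro!: sum.cong)
qed

lemma mdeg_Suc: "mdeg (Suc m) x = mdeg m x + x m"
  by (simp add: mdeg_def)

lemma decrement_above:
  assumes "g \<le> x" "mdeg m g < mdeg m x"
  shows "\<exists>y. g \<le> y \<and> y \<le> x \<and> mdeg m y + 1 = mdeg m x"
proof -
  obtain i where i: "i < m" "g i < x i"
    using assms(2) unfolding mdeg_def by (meson lessThan_iff not_le sum_mono)
  have "mdeg m (x(i := x i - 1)) + 1 = mdeg m x"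
    using mdeg_upd[of i m x "x i - 1"] i by simp
  moreover have "g \<le> x(i := x i - 1)" "x(i := x i - 1) \<le> x"
    using i assms(1) by (auto simp: le_fun_def)
  ultimately show ?thesis by blast
qed

text \<open>Everything by which \<open>z\<close> exceeds \<open>g\<close> can be moved to the last coordinate.\<close>

lemma stable_move_to_last:
  assumes V: "stable (Suc m) V"
  shows "z \<in> V \<Longrightarrow> z \<in> monomials (Suc m) \<Longrightarrow> g \<in> monomials m \<Longrightarrow> g \<le> z \<Longrightarrow>
    g(m := mdeg (Suc m) z - mdeg m g) \<in> V"
proof (induction "mdeg m z" arbitrary: z rule: less_induct)
  case less
  show ?case
  proof (cases "\<exists>i<m. g i < z i")
    case True
    then obtain i where i: "i < m" "g i < z i" by blast
    let ?y = "z(i := z i - 1, m := Suc (z m))"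
    have "?y \<in> V" using V less.prems(1) i unfolding stable_def by (metis lessI not_less_zero zero_less_iff_neq_zero)
    moreover have "?y \<in> monomials (Suc m)" using less.prems i by (auto simp: monomials_def)
    moreover have "g \<le> ?y" using less.prems i by (auto simp: le_fun_def monomials_def)
    moreover have "mdeg m ?y + 1 = mdeg m z"
      using mdeg_upd[of i m z "z i - 1"] i by (simp add: mdeg_upd_ge)
    moreover from this have "mdeg (Suc m) ?y = mdeg (Suc m) z" by (simp add: mdeg_Suc)
    ultimately show ?thesis using less.hyps[of ?y] less.prems(3) by simp
  next
    case False
    then have eq: "g i = z i" if "i < m" for i
      using less.prems(4) that by (metis le_antisym le_fun_def not_le)
    then have "mdeg m g = mdeg m z" by (simp add: mdeg_def)
    moreover have "z = g(m := z m)"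
      using eq less.prems by (auto simp: fun_eq_iff monomials_def)
        (metis le_eq_less_or_eq linorder_neqE_nat not_less_eq)
    ultimately show ?thesis using less.prems(1) by (simp add: mdeg_Suc)
  qed
qed

section \<open>Counting the points of stable order ideals\<close>

text \<open>The complement of \<open>V\<close>, a monomial ideal if \<open>V\<close> is an order ideal, is generated by its elements
of degree at most \<open>l\<close>.\<close>

definition generated_in_degree :: "nat \<Rightarrow> (nat \<Rightarrow> nat) set \<Rightarrow> nat \<Rightarrow> bool" where
  "generated_in_degree m V l \<longleftrightarrow>
     (\<forall>y\<in>monomials m - V. \<exists>g\<in>monomials m - V. g \<le> y \<and> mdeg m g \<le> l)"

text \<open>In terms of monomial ideals: the saturation with respect to the last variable, restricted to the
hyperplane where this variable is absent.\<close>

definition stable_part :: "nat \<Rightarrow> (nat \<Rightarrow> nat) set \<Rightarrow> (nat \<Rightarrow> nat) set" where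
  "stable_part m V = {u \<in> monomials m. \<forall>k. u(m := k) \<in> V}"

definition cylinder :: "nat \<Rightarrow> (nat \<Rightarrow> nat) set \<Rightarrow> (nat \<Rightarrow> nat) set" where
  "cylinder m U = {x \<in> monomials (Suc m). x(m := 0) \<in> U}"

lemma monomials_Suc_upd: "x \<in> monomials (Suc m) \<Longrightarrow> x(m := 0) \<in> monomials m"
  by (auto simp: monomials_def)

text \<open>A point of the cylinder of degree at most \<open>s\<close> with last coordinate \<open>k\<close> projects to a point of
degree at most \<open>s - k\<close>.\<close>

lemma card_up_to_degree_cylinder:
  assumes U: "U \<subseteq> monomials m"
  shows "card (up_to_degree (Suc m) (cylinder m U) s) = (\<Sum>t\<le>s. card (up_to_degree m U t))"
proof -
  have u0: "u m = 0" if "u \<in> U" for u using that U by (auto simp: monomials_def)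
  have "bij_betw (\<lambda>(t, u). u(m := s - t)) (SIGMA t:{..s}. up_to_degree m U t) (up_to_degree (Suc m) (cylinder m U) s)"
    by (rule bij_betw_byWitness[where f' = "\<lambda>x. (s - x m, x(m := 0))"])
      (use U u0 in \<open>auto simp: up_to_degree_def cylinder_def mdeg_Suc mdeg_upd_ge fun_upd_idem monomials_def\<close>)
  then have "card (up_to_degree (Suc m) (cylinder m U) s) = card (SIGMA t:{..s}. up_to_degree m U t)"
    by (simp add: bij_betw_same_card)
  then show ?thesis using finite_up_to_degree[OF U] by simp
qed

lemma order_ideal_stable_part:
  assumes "order_ideal (Suc m) V"
  shows "order_ideal m (stable_part m V)"
  unfolding order_ideal_def
proof (intro conjI ballI allI impI)
  fix x y assume x: "x \<in> stable_part m V" and y: "y \<le> x"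
  have "y(m := k) \<le> x(m := k)" for k using y by (auto simp: le_fun_def)
  moreover have "y \<in> monomials m"
    using x y by (auto simp: stable_part_def monomials_def le_fun_def) (metis le_zero_eq)
  ultimately show "y \<in> stable_part m V"
    using x order_idealD[OF assms] unfolding stable_part_def by blast
qed (auto simp: stable_part_def)

lemma stable_stable_part:
  assumes "stable (Suc m) V"
  shows "stable m (stable_part m V)"
  unfolding stable_def
proof (intro ballI allI impI)
  fix x i j assume x: "x \<in> stable_part m V" and ij: "i < j" "j < m" and pos: "0 < x i"
  have "x(i := x i - 1, j := Suc (x j), m := k) \<in> V" for k
  proof -
    let ?z = "x(m := k)"
    have z: "?z \<in> V" using x by (simp add: stable_part_def)
    have "0 < ?z i" "j < Suc m" using ij pos by auto
    then have "?z(i := ?z i - 1, j := Suc (?z j)) \<in> V"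
      using assms z ij(1) unfolding stable_def by blast
    moreover have "?z(i := ?z i - 1, j := Suc (?z j)) = x(i := x i - 1, j := Suc (x j), m := k)"
      using ij by (auto simp: fun_eq_iff)
    ultimately show ?thesis by simp
  qed
  then show "x(i := x i - 1, j := Suc (x j)) \<in> stable_part m V"
    using x ij by (auto simp: stable_part_def monomials_def)
qed

lemma cylinder_stable_part_subset: "cylinder m (stable_part m V) \<subseteq> V"
proof
  fix x assume "x \<in> cylinder m (stable_part m V)"
  then have "\<forall>k. (x(m := 0))(m := k) \<in> V" by (simp add: cylinder_def stable_part_def)
  from spec[OF this, of "x m"] show "x \<in> V" by simp
qed

text \<open>A point outside the cylinder lies above a generator of degree at most \<open>l\<close>.  If its own degree is
larger, then it can be decreased by a unit while staying above the generator.\<close>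

lemma outside_cylinder_decrement:
  assumes V: "order_ideal (Suc m) V" and gen: "generated_in_degree m (stable_part m V) l"
    and x: "x \<in> monomials (Suc m)" "x \<notin> cylinder m (stable_part m V)" and deg: "l < mdeg (Suc m) x"
  shows "\<exists>y. y \<in> monomials (Suc m) \<and> y \<notin> cylinder m (stable_part m V) \<and> y \<le> x \<and>
    mdeg (Suc m) y + 1 = mdeg (Suc m) x"
proof -
  have "x(m := 0) \<in> monomials m - stable_part m V"
    using x by (auto simp: cylinder_def monomials_Suc_upd)
  then obtain g where g: "g \<in> monomials m" "g \<notin> stable_part m V" "g \<le> x(m := 0)" "mdeg m g \<le> l"
    using gen unfolding generated_in_degree_def by blast
  have gm: "g m = 0" using g(1) by (simp add: monomials_def)
  have "x(m := 0) \<le> x" by (simp add: le_fun_def)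
  then have "g \<le> x" using g(3) by (rule order_trans[rotated])
  moreover have "mdeg (Suc m) g < mdeg (Suc m) x" using g gm deg by (simp add: mdeg_Suc)
  ultimately obtain y where y: "g \<le> y" "y \<le> x" "mdeg (Suc m) y + 1 = mdeg (Suc m) x"
    using decrement_above by blast
  have "g \<le> y(m := 0)" using y(1) gm by (simp add: le_fun_def)
  then have "y(m := 0) \<notin> stable_part m V"
    using g(2) order_idealD[OF order_ideal_stable_part[OF V]] by blast
  moreover have "y \<in> monomials (Suc m)"
    using x(1) y(2) by (auto simp: monomials_def le_fun_def) (metis Suc_le_eq le_zero_eq)
  ultimately show ?thesis using y by (auto simp: cylinder_def)
qed

text \<open>There are finitely many \<open>g\<close> of degree at most \<open>l\<close> outside \<open>U\<close>, and a single \<open>k\<close> works for all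
of them: \<open>g\<close> with \<open>k\<close> in the last coordinate is outside \<open>V\<close>.  A point \<open>x\<close> of \<open>V\<close> outside the
cylinder lies above such a \<open>g\<close>.  If it had degree at least \<open>l + k\<close>, then moving its excess
over \<open>g\<close> to the last coordinate would give a point of \<open>V\<close> above an excluded one.\<close>

lemma finite_outside_cylinder:
  assumes V: "order_ideal (Suc m) V" and st: "stable (Suc m) V"
    and gen: "generated_in_degree m (stable_part m V) l"
  shows "finite (V - cylinder m (stable_part m V))"
proof -
  let ?U = "stable_part m V"
  define G where "G = {g \<in> monomials m - ?U. mdeg m g \<le> l}"
  have "finite G"
    by (rule finite_subset[OF _ finite_up_to_degree[of "monomials m" m l]]) (auto simp: G_def up_to_degree_def)
  have "\<forall>g\<in>G. \<exists>k. g(m := k) \<notin> V" by (auto simp: G_def stable_part_def)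
  then obtain K where K: "\<And>g. g \<in> G \<Longrightarrow> g(m := K g) \<notin> V" by metis
  define k where "k = Max (insert 0 (K ` G))"
  have k: "K g \<le> k" if "g \<in> G" for g using that \<open>finite G\<close> by (simp add: k_def)
  have "mdeg (Suc m) x < l + k" if "x \<in> V - cylinder m ?U" for x
  proof (rule ccontr)
    assume deg: "\<not> ?thesis"
    have x: "x \<in> V" "x \<in> monomials (Suc m)" "x(m := 0) \<in> monomials m - ?U"
      using that order_ideal_monomials[OF V] by (auto simp: cylinder_def monomials_Suc_upd)
    then obtain g where g: "g \<in> monomials m - ?U" "g \<le> x(m := 0)" "mdeg m g \<le> l"
      using gen unfolding generated_in_degree_def by blast
    have "x(m := 0) \<le> x" by (simp add: le_fun_def)
    then have "g \<le> x" using g(2) by (rule order_trans[rotated])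
    then have *: "g(m := mdeg (Suc m) x - mdeg m g) \<in> V"
      using stable_move_to_last[OF st x(1,2)] g by blast
    have "g \<in> G" using g by (simp add: G_def)
    then have "K g \<le> mdeg (Suc m) x - mdeg m g" using k[of g] g(3) deg by linarith
    then have "g(m := K g) \<le> g(m := mdeg (Suc m) x - mdeg m g)" by (simp add: le_fun_def)
    from order_idealD[OF V * this] show False using K[OF \<open>g \<in> G\<close>] by simp
  qed
  then have "V - cylinder m ?U \<subseteq> up_to_degree (Suc m) V (l + k)" by (auto simp: up_to_degree_def less_imp_le)
  moreover have "V \<subseteq> monomials (Suc m)" using V by (simp add: order_ideal_def)
  ultimately show ?thesis using finite_up_to_degree finite_subset by blast
qed

text \<open>The degrees of \<open>X\<close> above \<open>l\<close> have no gaps, so an element of degree \<open>d \<ge> l\<close> is accompanied by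
elements of all degrees from \<open>l\<close> to \<open>d\<close>.\<close>

lemma consecutive_degrees:
  fixes f :: "'a \<Rightarrow> nat"
  assumes X: "finite X" and step: "\<And>x. x \<in> X \<Longrightarrow> l < f x \<Longrightarrow> \<exists>y\<in>X. f y + 1 = f x"
  shows "x \<in> X \<Longrightarrow> f x < l + card X"
    and "min (card X) (s + 1 - l) \<le> card {x \<in> X. f x \<le> s}"
proof -
  have down: "\<exists>y\<in>X. f y = d" if "x \<in> X" "l \<le> d" "d \<le> f x" for x d
    using that(3)
  proof (induction d rule: inc_induct)
    case (step n)
    then obtain y where "y \<in> X" "f y = Suc n" by blast
    moreover have "l < Suc n" using step that by simp
    ultimately show ?case using assms(2)[of y] by auto
  qed (use that in blast)
  have many: "Suc d - l \<le> card {x \<in> X. f x \<le> d}" if "x \<in> X" "d \<le> f x" for x d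
  proof -
    have "{l..d} \<subseteq> f ` {x \<in> X. f x \<le> d}" using down[OF that(1)] that(2) by fastforce
    then have "card {l..d} \<le> card (f ` {x \<in> X. f x \<le> d})" using X by (intro card_mono) auto
    also have "\<dots> \<le> card {x \<in> X. f x \<le> d}" using X by (intro card_image_le) auto
    finally show ?thesis by simp
  qed
  show "f x < l + card X" if "x \<in> X"
  proof -
    have "Suc (f x) - l \<le> card X"
      using many[OF that order_refl] card_mono[OF X, of "{y \<in> X. f y \<le> f x}"] by auto
    moreover have "card X > 0" using that X by (auto simp: card_gt_0_iff)
    ultimately show ?thesis by linarith
  qed
  show "min (card X) (s + 1 - l) \<le> card {x \<in> X. f x \<le> s}"
  proof (cases "\<exists>x\<in>X. s < f x")
    case True
    then show ?thesis using many[of _ s] by fastforce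
  next
    case False
    then have "{x \<in> X. f x \<le> s} = X" by (auto simp: not_less)
    then show ?thesis by simp
  qed
qed

text \<open>The lower bound makes the accumulated error \<open>c\<close> of \<open>U\<close> non-negative, and agreement from
\<open>length \<nu>\<close> on makes it constant.  Generation in low degree controls the remainder \<open>X\<close>.  Each of
the \<open>c + card X\<close> appended zeros lengthens the sequence, and with it the range of degrees that
the bounds for \<open>V\<close> leave free.\<close>

lemma stable_order_ideal_count:
  assumes "order_ideal m V" "stable m V"
  shows "\<exists>\<mu>. sorted (rev \<mu>) \<and> (\<forall>t. macaulay_sum \<mu> t \<le> card (up_to_degree m V t)) \<and>
    (\<forall>t\<ge>length \<mu>. card (up_to_degree m V t) = macaulay_sum \<mu> t) \<and> generated_in_degree m V (length \<mu>)"
  using assms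
proof (induction m arbitrary: V)
  case 0
  have m0: "monomials 0 = {\<lambda>_. 0}" by (auto simp: monomials_def)
  then consider "V = {}" | "V = {\<lambda>_. 0}" using 0 by (auto simp: order_ideal_def)
  then show ?case
  proof cases
    case 1
    then show ?thesis
      by (intro exI[of _ "[]"]) (auto simp: macaulay_sum_def up_to_degree_def generated_in_degree_def m0 mdeg_def)
  next
    case 2
    then have "up_to_degree 0 V t = {\<lambda>_. 0}" for t by (auto simp: up_to_degree_def mdeg_def)
    then show ?thesis
      using 2 by (intro exI[of _ "[0]"]) (auto simp: macaulay_sum_def generated_in_degree_def m0)
  qed
next
  case (Suc m)
  define U where "U = stable_part m V"
  define C where "C = cylinder m U"
  define X where "X = V - C"
  note V = Suc.prems(1)
  have U: "order_ideal m U" "stable m U"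
    unfolding U_def using Suc.prems by (auto intro: order_ideal_stable_part stable_stable_part)
  from Suc.IH[OF this] obtain \<nu> where \<nu>: "sorted (rev \<nu>)"
    "\<And>t. macaulay_sum \<nu> t \<le> card (up_to_degree m U t)"
    "\<And>t. t \<ge> length \<nu> \<Longrightarrow> card (up_to_degree m U t) = macaulay_sum \<nu> t"
    and gen: "generated_in_degree m U (length \<nu>)" by blast
  define l where "l = length \<nu>"
  define c where "c = (\<Sum>t<l. card (up_to_degree m U t) - macaulay_sum \<nu> t)"
  have sub: "V \<subseteq> monomials (Suc m)" "U \<subseteq> monomials m" "C \<subseteq> V"
    using V U cylinder_stable_part_subset by (auto simp: order_ideal_def C_def U_def)
  have X: "finite X"
    unfolding X_def C_def U_def
    by (rule finite_outside_cylinder[OF Suc.prems]) (use gen in \<open>simp add: U_def\<close>)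
  have dec: "\<exists>y. y \<in> monomials (Suc m) \<and> y \<notin> C \<and> y \<le> x \<and> mdeg (Suc m) y + 1 = mdeg (Suc m) x"
    if "x \<in> monomials (Suc m)" "x \<notin> C" "l < mdeg (Suc m) x" for x
    using outside_cylinder_decrement[OF V] gen that by (simp add: C_def U_def l_def)
  have "\<exists>y\<in>X. mdeg (Suc m) y + 1 = mdeg (Suc m) x" if "x \<in> X" "l < mdeg (Suc m) x" for x
  proof -
    have "x \<in> V" "x \<notin> C" using that by (auto simp: X_def)
    then show ?thesis using dec[of x] that(2) sub(1) order_idealD[OF V, of x] unfolding X_def by blast
  qed
  note Xdeg = consecutive_degrees[OF X this]
  have Xdeg1: "mdeg (Suc m) x < l + card X" if "x \<in> X" for x
    using Xdeg(1) that by blast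
  have Xdeg2: "min (card X) (s + 1 - l) \<le> card {x \<in> X. mdeg (Suc m) x \<le> s}" for s
    using Xdeg(2) by blast
  have split: "card (up_to_degree (Suc m) V s)
      = (\<Sum>t\<le>s. card (up_to_degree m U t)) + card {x \<in> X. mdeg (Suc m) x \<le> s}" for s
  proof -
    have "up_to_degree (Suc m) V s = up_to_degree (Suc m) C s \<union> {x \<in> X. mdeg (Suc m) x \<le> s}"
      using sub by (auto simp: up_to_degree_def X_def)
    moreover have "up_to_degree (Suc m) C s \<inter> {x \<in> X. mdeg (Suc m) x \<le> s} = {}"
      by (auto simp: up_to_degree_def X_def)
    ultimately show ?thesis
      using X finite_up_to_degree[of C "Suc m" s] sub card_up_to_degree_cylinder[OF sub(2), of s]
      by (simp add: card_Un_disjoint C_def)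
  qed
  have low: "macaulay_sum (map Suc \<nu>) s \<le> (\<Sum>t\<le>s. card (up_to_degree m U t))" for s
    unfolding macaulay_sum_map_Suc by (rule sum_mono) (rule \<nu>(2))
  have high: "(\<Sum>t\<le>s. card (up_to_degree m U t)) = macaulay_sum (map Suc \<nu>) s + c" if "l \<le> s + 1" for s
  proof -
    have "(\<Sum>t\<le>s. card (up_to_degree m U t) - macaulay_sum \<nu> t) = c"
      unfolding c_def using that \<nu>(3) by (intro sum.mono_neutral_right) (auto simp: l_def)
    moreover have "(\<Sum>t\<le>s. card (up_to_degree m U t))
        = (\<Sum>t\<le>s. macaulay_sum \<nu> t + (card (up_to_degree m U t) - macaulay_sum \<nu> t))"
      using \<nu>(2) by (intro sum.cong) auto
    ultimately show ?thesis by (simp add: macaulay_sum_map_Suc sum.distrib)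
  qed
  define \<mu> where "\<mu> = map Suc \<nu> @ replicate (c + card X) 0"
  have len: "length \<mu> = l + c + card X" by (simp add: \<mu>_def l_def)
  have ms: "macaulay_sum \<mu> s = macaulay_sum (map Suc \<nu>) s + min (c + card X) (s + 1 - l)" for s
    by (simp add: \<mu>_def macaulay_sum_append_zeros l_def)
  have "sorted (rev \<mu>)"
    using \<nu>(1) by (simp add: \<mu>_def sorted_append rev_map sorted_map)
  moreover have "macaulay_sum \<mu> t \<le> card (up_to_degree (Suc m) V t)" for t
  proof (cases "l \<le> t + 1")
    case True
    then show ?thesis using high[of t] Xdeg2[of t] by (simp add: split ms)
  next
    case False
    then show ?thesis using low[of t] by (simp add: split ms)
  qed
  moreover have "card (up_to_degree (Suc m) V t) = macaulay_sum \<mu> t" if "length \<mu> \<le> t" for t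
  proof -
    have "{x \<in> X. mdeg (Suc m) x \<le> t} = X" using Xdeg1 that len by fastforce
    then show ?thesis using high[of t] that len by (simp add: split ms)
  qed
  moreover have "generated_in_degree (Suc m) V (length \<mu>)"
    unfolding generated_in_degree_def
  proof
    fix y assume "y \<in> monomials (Suc m) - V"
    then show "\<exists>g\<in>monomials (Suc m) - V. g \<le> y \<and> mdeg (Suc m) g \<le> length \<mu>"
    proof (induction "mdeg (Suc m) y" arbitrary: y rule: less_induct)
      case less
      show ?case
      proof (cases "mdeg (Suc m) y \<le> length \<mu>")
        case True
        then show ?thesis using less.prems by auto
      next
        case False
        moreover have "y \<notin> C" using less.prems sub by auto
        ultimately obtain z where z: "z \<in> monomials (Suc m)" "z \<notin> C" "z \<le> y"
          "mdeg (Suc m) z + 1 = mdeg (Suc m) y"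
          using dec[of y] less.prems len by auto
        \<comment> \<open>Otherwise \<open>z\<close> would belong to \<open>X\<close>, whose degrees are below \<open>l + card X\<close>.\<close>
        have "z \<notin> V" using Xdeg1[of z] z False len by (auto simp: X_def)
        then obtain g where "g \<in> monomials (Suc m) - V" "g \<le> z" "mdeg (Suc m) g \<le> length \<mu>"
          using less.hyps[of z] z by auto
        then show ?thesis using z(3) order_trans by blast
      qed
    qed
  qed
  ultimately show ?case by blast
qed

lemma order_ideal_count:
  assumes V: "order_ideal m V"
  shows "\<exists>\<mu>. sorted (rev \<mu>) \<and> (\<forall>\<^sub>F t in sequentially. card (up_to_degree m V t) = macaulay_sum \<mu> t)"
proof -
  obtain W where W: "order_ideal m W" "stable m W" "\<And>t. card (layer m W t) = card (layer m V t)"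
    using stable_order_ideal_exists[OF V] by blast
  have "card (up_to_degree m V t) = card (up_to_degree m W t)" for t
    using V W by (simp add: card_up_to_degree_eq_sum_layer order_ideal_def)
  moreover obtain \<mu> where "sorted (rev \<mu>)"
    "\<forall>t\<ge>length \<mu>. card (up_to_degree m W t) = macaulay_sum \<mu> t"
    using stable_order_ideal_count[OF W(1,2)] by blast
  ultimately show ?thesis
    by (intro exI[of _ \<mu>]) (auto simp: eventually_sequentially)
qed

section \<open>Minimizing coefficients of Macaulay sums\<close>

lemma poly_eqI_eventually:
  fixes p q :: "real poly"
  assumes "\<forall>\<^sub>F s in sequentially. poly p (real s) = poly q (real s)"
  shows "p = q"
proof -
  obtain N where N: "\<And>s. s \<ge> N \<Longrightarrow> poly (p - q) (real s) = 0"
    using assms by (auto simp: eventually_sequentially)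
  then have "real ` {N..} \<subseteq> {x. poly (p - q) x = 0}" by auto
  moreover have "infinite (real ` {N..})"
    by (simp add: finite_image_iff inj_on_def infinite_Ici)
  ultimately have "p - q = 0" using poly_roots_finite finite_subset by blast
  then show ?thesis by simp
qed

definition macaulay_poly :: "nat list \<Rightarrow> real poly" where
  "macaulay_poly \<mu> = (\<Sum>j<length \<mu>. binom_poly (int (\<mu> ! j) - int j) (\<mu> ! j))"

lemma poly_macaulay_poly:
  assumes "length \<mu> \<le> t"
  shows "poly (macaulay_poly \<mu>) (real t) = real (macaulay_sum \<mu> t)"
proof -
  have "real t + of_int (int (\<mu> ! j) - int j) gchoose (\<mu> ! j) = real ((t - j + \<mu> ! j) choose (\<mu> ! j))"
    if "j < length \<mu>" for j
  proof -
    have "real t + of_int (int (\<mu> ! j) - int j) = real (t - j + \<mu> ! j)"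
      using that assms by (simp add: of_nat_diff)
    then show ?thesis by (simp only: binomial_gbinomial)
  qed
  then show ?thesis
    using assms by (auto simp: macaulay_poly_def macaulay_sum_def poly_sum poly_binom_poly intro!: sum.cong)
qed

text \<open>If \<open>d\<close> is the largest entry, this is the leading coefficient; it shows that the leading standard
coefficient is the number of entries equal to \<open>d\<close>.\<close>

lemma coeff_macaulay_poly:
  assumes "\<And>k. k \<in> set \<mu> \<Longrightarrow> k \<le> d"
  shows "coeff (macaulay_poly \<mu>) d = real (length (filter (\<lambda>k. k = d) \<mu>)) / fact d"
proof -
  have "coeff (macaulay_poly \<mu>) d = (\<Sum>j<length \<mu>. if \<mu> ! j = d then 1 / fact d else 0)"
    unfolding macaulay_poly_def coeff_sum
  proof (rule sum.cong)
    fix j assume "j \<in> {..<length \<mu>}"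
    then have "\<mu> ! j \<le> d" using assms by auto
    then show "coeff (binom_poly (int (\<mu> ! j) - int j) (\<mu> ! j)) d = (if \<mu> ! j = d then 1 / fact d else 0)"
      by (auto simp: lead_coeff_binom_poly coeff_eq_0 degree_binom_poly)
  qed simp
  also have "\<dots> = real (card ({..<length \<mu>} \<inter> {j. \<mu> ! j = d})) / fact d"
    by (simp add: sum.If_cases)
  also have "{..<length \<mu>} \<inter> {j. \<mu> ! j = d} = {j. j < length \<mu> \<and> \<mu> ! j = d}" by auto
  finally show ?thesis by (simp add: length_filter_conv_card)
qed

lemma degree_macaulay_poly_le:
  assumes "\<And>k. k \<in> set \<mu> \<Longrightarrow> k \<le> d"
  shows "degree (macaulay_poly \<mu>) \<le> d"
  unfolding macaulay_poly_def using assms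
  by (intro degree_sum_le) (auto simp: degree_binom_poly)

lemma coeff_eq_std_coeff:
  assumes "numerical p"
  shows "coeff p (degree p) = of_int (std_coeff p (degree p)) / fact (degree p)"
  using is_std_coeff_std_coeff[OF assms] coeff_binom_sum_top[of "std_coeff p" "degree p"]
  unfolding is_std_coeff_def by metis

lemma sum_gbinomial_block:
  fixes x :: real
  shows "(\<Sum>j<a. (x + real a + real d - real j) gchoose d)
    = (x + real d + 1 + real a gchoose Suc d) - (x + real d + 1 gchoose Suc d)"
proof (induction a)
  case (Suc a)
  have "(\<Sum>j<Suc a. (x + real (Suc a) + real d - real j) gchoose d)
     = (x + real d + 1 + real a gchoose d) + (\<Sum>j<a. (x + real a + real d - real j) gchoose d)"
    by (subst sum.lessThan_Suc_shift) (simp add: algebra_simps)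
  then show ?case
    using Suc gbinomial_Suc_Suc[of "x + real d + 1 + real a" d] by (simp add: algebra_simps)
qed simp

text \<open>A leading block of length \<open>a\<close> telescopes to the difference of binomials in the definition of
\<open>v\<close>, and the shift of the argument by \<open>a\<close> compensates for the positions that it occupies.\<close>

lemma macaulay_poly_block:
  "poly (macaulay_poly (replicate a d @ \<mu>)) (x + real a)
     = (x + real d + 1 + real a gchoose Suc d) - (x + real d + 1 gchoose Suc d) + poly (macaulay_poly \<mu>) x"
proof -
  let ?\<mu> = "replicate a d @ \<mu>"
  let ?f = "\<lambda>j. poly (binom_poly (int (?\<mu> ! j) - int j) (?\<mu> ! j)) (x + real a)"
  have "poly (macaulay_poly ?\<mu>) (x + real a) = (\<Sum>j<a + length \<mu>. ?f j)"
    by (simp add: macaulay_poly_def poly_sum)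
  also have "\<dots> = (\<Sum>j<a. ?f j) + (\<Sum>j<length \<mu>. ?f (a + j))"
  proof -
    have "sum f {..<a + n} = sum f {..<a} + (\<Sum>j<n. f (a + j))" for f :: "nat \<Rightarrow> real" and n
      by (induction n) auto
    then show ?thesis .
  qed
  also have "(\<Sum>j<a. ?f j) = (\<Sum>j<a. (x + real a + real d - real j) gchoose d)"
    by (intro sum.cong) (auto simp: poly_binom_poly nth_append algebra_simps)
  also have "(\<Sum>j<length \<mu>. ?f (a + j)) = poly (macaulay_poly \<mu>) x"
    unfolding macaulay_poly_def poly_sum
    by (intro sum.cong) (auto simp: poly_binom_poly nth_append algebra_simps)
  finally show ?thesis by (simp add: sum_gbinomial_block)
qed

lemma poly_min_step:
  "poly (min_step p) x = poly p (x + of_int (std_coeff p (degree p)))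
     - (x + real (degree p) + 1 + of_int (std_coeff p (degree p)) gchoose Suc (degree p))
     + (x + real (degree p) + 1 gchoose Suc (degree p))"
  by (simp add: min_step_def Let_def poly_pcompose poly_binom_poly algebra_simps)

text \<open>One step of the recursion for minimizing coefficients yields the length of the leading block of
\<open>\<mu>\<close> and continues with the remaining sequence.\<close>

lemma min_coeffs_macaulay_poly_nonneg:
  "sorted (rev \<mu>) \<Longrightarrow> numerical (macaulay_poly \<mu>) \<Longrightarrow> \<forall>b\<in>set (min_coeffs (macaulay_poly \<mu>)). 0 \<le> b"
proof (induction "length \<mu>" arbitrary: \<mu> rule: less_induct)
  case less
  let ?p = "macaulay_poly \<mu>"
  show ?case
  proof (cases \<mu>)
    case Nil
    then have "?p = 0" by (simp add: macaulay_poly_def)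
    then show ?thesis using less.prems by (subst min_coeffs.simps) simp
  next
    case (Cons d \<mu>1)
    define \<mu>' where "\<mu>' = dropWhile (\<lambda>k. k = d) \<mu>"
    define a where "a = length (takeWhile (\<lambda>k. k = d) \<mu>)"
    have "takeWhile (\<lambda>k. k = d) \<mu> = replicate a d"
      unfolding a_def by (rule replicate_eqI) (auto dest: set_takeWhileD)
    then have split: "\<mu> = replicate a d @ \<mu>'"
      unfolding \<mu>'_def by (metis takeWhile_dropWhile_id)
    have a: "a > 0" using Cons by (simp add: a_def)
    have le: "k \<le> d" if "k \<in> set \<mu>" for k
      using less.prems(1) that Cons by (auto simp: sorted_append)
    have lt: "k \<noteq> d" if "k \<in> set \<mu>'" for k
    proof (cases \<mu>')
      case (Cons h ts)
      then have "h \<noteq> d" using hd_dropWhile[of "\<lambda>k. k = d" \<mu>] by (simp add: \<mu>'_def)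
      moreover have "h \<in> set \<mu>" using split Cons by simp
      ultimately have "h < d" using le[of h] by simp
      moreover have "k \<le> h"
        using that less.prems(1) Cons by (auto simp: split sorted_append)
      ultimately show ?thesis by simp
    qed (use that in simp)
    have "filter (\<lambda>k. k = d) \<mu>' = []" using lt by (auto simp: filter_empty_conv)
    then have "length (filter (\<lambda>k. k = d) \<mu>) = a" by (subst split) simp
    then have co: "coeff ?p d = real a / fact d" by (simp add: coeff_macaulay_poly[OF le])
    have deg: "degree ?p = d"
    proof (rule antisym)
      show "degree ?p \<le> d" by (rule degree_macaulay_poly_le[OF le])
      show "d \<le> degree ?p" using co a by (intro le_degree) simp
    qed
    have std: "std_coeff ?p d = int a"
      using coeff_eq_std_coeff[OF less.prems(2)] co by (simp add: deg)
    show ?thesis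
    proof (cases "d = 0")
      case True
      then show ?thesis using less.prems(2) deg co by (subst min_coeffs.simps) simp
    next
      case False
      have "poly (min_step ?p) x = poly (macaulay_poly \<mu>') x" for x
        using macaulay_poly_block[of a d \<mu>' x] by (simp add: poly_min_step deg std flip: split)
      then have ms: "min_step ?p = macaulay_poly \<mu>'" by (simp add: poly_eq_poly_eq_iff[symmetric] ext)
      have "\<forall>b\<in>set (min_coeffs (macaulay_poly \<mu>')). 0 \<le> b"
      proof (rule less.hyps)
        show "length \<mu>' < length \<mu>" using split a by (metis add_less_same_cancel2 length_append length_replicate less_add_same_cancel2)
        show "sorted (rev \<mu>')" using less.prems(1) by (simp add: split sorted_append)
        show "numerical (macaulay_poly \<mu>')" using numerical_min_step[OF less.prems(2)] ms by simp
      qed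
      then show ?thesis
        using False less.prems(2) deg std ms by (subst min_coeffs.simps) (auto simp: Let_def)
    qed
  qed
qed

text \<open>The lists avoiding \<open>E\<close> are translated into an order ideal, whose counting function is eventually
a Macaulay sum.\<close>

lemma kolchin_poly_min_coeffs_nonneg:
  assumes "E \<subseteq> {x. length x = m}" "kolchin_poly_of m E p"
  shows "\<forall>b\<in>set (min_coeffs p). 0 \<le> b"
proof -
  define V where "V = {x \<in> monomials m. \<not> (\<exists>e\<in>E. list_all2 (\<le>) e (map x [0..<m]))}"
  have card: "card (up_to_degree m V s) = card (kolchin_set m E s)" for s
  proof (rule bij_betw_same_card[of "\<lambda>x. map x [0..<m]"], rule bij_betw_byWitness[where f' = "\<lambda>l i. if i < m then l ! i else 0"])
    show "\<forall>x\<in>up_to_degree m V s. (\<lambda>i. if i < m then map x [0..<m] ! i else 0) = x"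
      by (auto simp: up_to_degree_def V_def monomials_def fun_eq_iff)
    show "\<forall>l\<in>kolchin_set m E s. map (\<lambda>i. if i < m then l ! i else 0) [0..<m] = l"
      by (auto simp: kolchin_set_def list_eq_iff_nth_eq)
    have deg: "sum_list (map x [0..<m]) = mdeg m x" for x
      by (simp add: mdeg_def interv_sum_list_conv_sum_set_nat atLeast0LessThan)
    show "(\<lambda>x. map x [0..<m]) ` up_to_degree m V s \<subseteq> kolchin_set m E s"
      by (auto simp: up_to_degree_def V_def kolchin_set_def deg)
    show "(\<lambda>l i. if i < m then l ! i else 0) ` kolchin_set m E s \<subseteq> up_to_degree m V s"
    proof clarify
      fix l assume l: "l \<in> kolchin_set m E s"
      let ?x = "\<lambda>i. if i < m then l ! i else 0"
      have "map ?x [0..<m] = l" using l by (auto simp: kolchin_set_def list_eq_iff_nth_eq)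
      then show "?x \<in> up_to_degree m V s"
        using l deg[of ?x] by (auto simp: up_to_degree_def V_def monomials_def kolchin_set_def)
    qed
  qed
  have "order_ideal m V"
    unfolding order_ideal_def
  proof (intro conjI ballI allI impI)
    fix x y assume x: "x \<in> V" and y: "y \<le> x"
    have "y \<in> monomials m"
      using x y by (auto simp: V_def monomials_def le_fun_def) (metis le_zero_eq)
    moreover have "list_all2 (\<le>) e (map x [0..<m])" if "list_all2 (\<le>) e (map y [0..<m])" for e
      using that y by (auto simp: list_all2_conv_all_nth le_fun_def intro: order_trans)
    ultimately show "y \<in> V" using x by (auto simp: V_def)
  qed (auto simp: V_def)
  then obtain \<mu> where \<mu>: "sorted (rev \<mu>)" "\<forall>\<^sub>F t in sequentially. card (up_to_degree m V t) = macaulay_sum \<mu> t"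
    using order_ideal_count by blast
  have "\<forall>\<^sub>F t in sequentially. poly p (real t) = poly (macaulay_poly \<mu>) (real t)"
    using \<mu>(2) assms(2)[unfolded kolchin_poly_of_def, THEN conjunct2] eventually_ge_at_top[of "length \<mu>"]
    by eventually_elim (simp add: poly_macaulay_poly card)
  then have "p = macaulay_poly \<mu>" by (rule poly_eqI_eventually)
  then show ?thesis
    using min_coeffs_macaulay_poly_nonneg[OF \<mu>(1)] assms(2) by (simp add: kolchin_poly_of_def)
qed

lemma list_all2_replicate_0: "list_all2 (\<le>) (replicate m (0::nat)) xs \<longleftrightarrow> length xs = m"
  by (auto simp: list_all2_conv_all_nth)

section \<open>Realising non-negative minimizing coefficients\<close>

text \<open>The generator \<open>(1, 0, \<dots>, 0)\<close> forces the additional coordinate to be \<open>0\<close>.\<close>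

lemma kolchin_poly_of_Suc:
  assumes "E \<subseteq> {x. length x = m}" "kolchin_poly_of m E p"
  shows "\<exists>E'\<subseteq>{x. length x = Suc m}. kolchin_poly_of (Suc m) E' p"
proof -
  let ?E = "insert (1 # replicate m 0) ((#) 0 ` E)"
  have "kolchin_set (Suc m) ?E s = (#) 0 ` kolchin_set m E s" for s
  proof (intro set_eqI iffI)
    fix x assume x: "x \<in> kolchin_set (Suc m) ?E s"
    then obtain h xs where [simp]: "x = h # xs" "length xs = m"
      by (auto simp: kolchin_set_def length_Suc_conv)
    have "h = 0" using x by (simp add: kolchin_set_def list_all2_replicate_0)
    then show "x \<in> (#) 0 ` kolchin_set m E s" using x by (auto simp: kolchin_set_def)
  qed (auto simp: kolchin_set_def)
  then have "card (kolchin_set (Suc m) ?E s) = card (kolchin_set m E s)" for s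
    by (simp add: card_image)
  then show ?thesis
    using assms by (intro exI[of _ ?E]) (auto simp: kolchin_poly_of_def)
qed

lemma kolchin_poly_of_ge:
  assumes "\<exists>E\<subseteq>{x. length x = m}. kolchin_poly_of m E p" "m \<le> n"
  shows "\<exists>E\<subseteq>{x. length x = n}. kolchin_poly_of n E p"
  using assms(2,1) by (induction n rule: dec_induct) (auto dest: kolchin_poly_of_Suc)

lemma card_lists_sum_le:
  "card {x::nat list. length x = n \<and> sum_list x \<le> s} = (s + n) choose n"
proof -
  \<comment> \<open>A slack coordinate turns the bound on the sum into an equation.\<close>
  have "bij_betw (\<lambda>x. (s - sum_list x) # x) {x::nat list. length x = n \<and> sum_list x \<le> s}
      {x. length x = Suc n \<and> sum_list x = s}"
    by (rule bij_betw_byWitness[where f' = tl]) (auto simp: length_Suc_conv)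
  then have "card {x::nat list. length x = n \<and> sum_list x \<le> s} = (s + n) choose s"
    by (simp add: bij_betw_same_card card_length_sum_list)
  then show ?thesis by (simp add: binomial_symmetric[of n "s + n"])
qed

text \<open>Both the set avoiding the translate of \<open>E\<close> and the full simplex of size \<open>s\<close> consist of the
points with first coordinate below \<open>a\<close> and a translated set: the one avoiding \<open>E\<close>, and the full
simplex of size \<open>s - a\<close>, respectively.\<close>

lemma card_kolchin_set_shift:
  fixes E :: "nat list set"
  assumes E: "E \<subseteq> {x. length x = Suc d}" and s: "a \<le> s"
  defines "sh \<equiv> \<lambda>x. (a + hd x) # tl x"
  shows "card (kolchin_set (Suc d) (sh ` E) s) + ((s - a + Suc d) choose Suc d)
    = ((s + Suc d) choose Suc d) + card (kolchin_set (Suc d) E (s - a))"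
proof -
  let ?B = "\<lambda>s. {x::nat list. length x = Suc d \<and> sum_list x \<le> s}"
  let ?L = "{x. length x = Suc d \<and> sum_list x \<le> s \<and> hd x < a}"
  have fin: "finite (?B s)" for s
    using finite_kolchin_set[of "Suc d" "{}" s] by (simp add: kolchin_set_def)
  have finL: "finite ?L" by (rule finite_subset[OF _ fin[of s]]) auto
  have inj: "inj_on sh A" if "A \<subseteq> {x. length x = Suc d}" for A
  proof (rule inj_onI)
    fix x y assume "x \<in> A" "y \<in> A" "sh x = sh y"
    moreover from this that obtain h k xs ys where "x = h # xs" "y = k # ys"
      by (metis (mono_tags, lifting) length_Suc_conv mem_Collect_eq subsetD)
    ultimately show "x = y" by (simp add: sh_def)
  qed
  have B: "?B s = ?L \<union> sh ` ?B (s - a)"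
  proof (intro set_eqI iffI)
    fix x assume x: "x \<in> ?B s"
    then obtain h xs where [simp]: "x = h # xs" by (auto simp: length_Suc_conv)
    show "x \<in> ?L \<union> sh ` ?B (s - a)"
    proof (cases "h < a")
      case False
      then have "x = sh ((h - a) # xs)" "(h - a) # xs \<in> ?B (s - a)" using x by (auto simp: sh_def)
      then show ?thesis by blast
    qed (use x in auto)
  qed (use s in \<open>auto simp: sh_def length_Suc_conv\<close>)
  have K: "kolchin_set (Suc d) (sh ` E) s = ?L \<union> sh ` kolchin_set (Suc d) E (s - a)"
  proof (intro set_eqI iffI)
    fix x assume x: "x \<in> kolchin_set (Suc d) (sh ` E) s"
    then obtain h xs where [simp]: "x = h # xs" by (auto simp: length_Suc_conv kolchin_set_def)
    show "x \<in> ?L \<union> sh ` kolchin_set (Suc d) E (s - a)"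
    proof (cases "h < a")
      case False
      have "\<not> list_all2 (\<le>) e ((h - a) # xs)" if "e \<in> E" for e
      proof
        assume le: "list_all2 (\<le>) e ((h - a) # xs)"
        then obtain k es where "e = k # es" by (cases e) auto
        then have "list_all2 (\<le>) (sh e) x" using le False by (auto simp: sh_def)
        then show False using x that by (auto simp: kolchin_set_def)
      qed
      then have "x = sh ((h - a) # xs)" "(h - a) # xs \<in> kolchin_set (Suc d) E (s - a)"
        using x False by (auto simp: sh_def kolchin_set_def)
      then show ?thesis by blast
    qed (use x in \<open>auto simp: kolchin_set_def\<close>)
  next
    fix x assume "x \<in> ?L \<union> sh ` kolchin_set (Suc d) E (s - a)"
    then show "x \<in> kolchin_set (Suc d) (sh ` E) s"
    proof
      assume "x \<in> ?L"
      then show ?thesis by (auto simp: kolchin_set_def sh_def length_Suc_conv)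
    next
      assume "x \<in> sh ` kolchin_set (Suc d) E (s - a)"
      then obtain y where y: "x = sh y" "y \<in> kolchin_set (Suc d) E (s - a)" by blast
      then obtain h xs where [simp]: "y = h # xs" by (auto simp: length_Suc_conv kolchin_set_def)
      have "\<not> list_all2 (\<le>) (sh e) x" if "e \<in> E" for e
      proof
        assume le: "list_all2 (\<le>) (sh e) x"
        have "length e = Suc d" using that E by blast
        then obtain k es where "e = k # es" by (cases e) auto
        then have "list_all2 (\<le>) e y" using le y(1) by (simp add: sh_def)
        then show False using y(2) that by (auto simp: kolchin_set_def)
      qed
      then show ?thesis using y s by (auto simp: kolchin_set_def sh_def)
    qed
  qed
  have disj: "?L \<inter> sh ` A = {}" for A by (auto simp: sh_def)
  have "card (sh ` ?B (s - a)) = card (?B (s - a))" by (rule card_image, rule inj) auto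
  then have "card (?B s) = card ?L + card (?B (s - a))"
    by (subst B) (use fin finL disj in \<open>simp add: card_Un_disjoint\<close>)
  moreover have "card (kolchin_set (Suc d) (sh ` E) s) = card ?L + card (kolchin_set (Suc d) E (s - a))"
  proof -
    have "kolchin_set (Suc d) E (s - a) \<subseteq> {x. length x = Suc d}" by (auto simp: kolchin_set_def)
    then show ?thesis
      unfolding K using finL disj inj finite_kolchin_set by (simp add: card_Un_disjoint card_image)
  qed
  ultimately show ?thesis by (simp only: card_lists_sum_le)
qed

lemma kolchin_poly_of_shift:
  assumes p: "numerical p" and E: "E \<subseteq> {x. length x = Suc (degree p)}"
    and v: "kolchin_poly_of (Suc (degree p)) E (min_step p)"
    and a: "std_coeff p (degree p) = int a"
  shows "kolchin_poly_of (Suc (degree p)) ((\<lambda>x. (a + hd x) # tl x) ` E) p"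
  unfolding kolchin_poly_of_def
proof
  define d where "d = degree p"
  obtain N where N: "\<And>s. s \<ge> N \<Longrightarrow>
      poly (min_step p) (real s) = real (card (kolchin_set (Suc d) E s))"
    using v by (auto simp: kolchin_poly_of_def eventually_sequentially d_def)
  have "poly p (real s) = real (card (kolchin_set (Suc d) ((\<lambda>x. (a + hd x) # tl x) ` E) s))"
    if "s \<ge> N + a" for s
  proof -
    have "real (card (kolchin_set (Suc d) ((\<lambda>x. (a + hd x) # tl x) ` E) s)) + real ((s - a + Suc d) choose Suc d)
        = real ((s + Suc d) choose Suc d) + real (card (kolchin_set (Suc d) E (s - a)))"
      using card_kolchin_set_shift[of E d a s] E that
      by (simp only: d_def flip: of_nat_add)
    moreover have "real (card (kolchin_set (Suc d) E (s - a)))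
        = poly p (real s) - (real s + real d + 1 gchoose Suc d) + (real (s - a) + real d + 1 gchoose Suc d)"
      using N[of "s - a"] that a by (simp add: poly_min_step d_def of_nat_diff algebra_simps)
    moreover have "real ((s + Suc d) choose Suc d) = (real s + real d + 1 gchoose Suc d)"
      "real ((s - a + Suc d) choose Suc d) = (real (s - a) + real d + 1 gchoose Suc d)"
      unfolding binomial_gbinomial by (simp_all add: algebra_simps)
    ultimately show ?thesis by linarith
  qed
  then show "\<forall>\<^sub>F s in sequentially. poly p (real s) = real (card (kolchin_set (Suc (degree p)) ((\<lambda>x. (a + hd x) # tl x) ` E) s))"
    unfolding eventually_sequentially d_def by blast
qed (rule p)

lemma kolchin_poly_const:
  "kolchin_poly_of 1 {[c]} [:real c:]"
proof -
  have "kolchin_set 1 {[c]} s = (\<lambda>k. [k]) ` {..<c}" if "s \<ge> c" for s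
    using that by (auto simp: kolchin_set_def length_Suc_conv)
  then have "card (kolchin_set 1 {[c]} s) = c" if "s \<ge> c" for s
    using that by (simp add: card_image inj_on_def)
  moreover have "numerical [:real c:]" by (simp add: numerical_def)
  ultimately show ?thesis
    by (auto simp: kolchin_poly_of_def eventually_sequentially intro!: exI[of _ c])
qed

lemma kolchin_poly_if_min_coeffs_nonneg:
  "numerical p \<Longrightarrow> \<forall>b\<in>set (min_coeffs p). 0 \<le> b \<Longrightarrow>
     \<exists>E\<subseteq>{x. length x = Suc (degree p)}. kolchin_poly_of (Suc (degree p)) E p"
proof (induction p rule: min_coeffs.induct)
  case (1 p)
  show ?case
  proof (cases "degree p = 0")
    case True
    then obtain r where r: "p = [:r:]" by (auto elim: degree_eq_zeroE)
    have "r \<in> \<int>" using 1(2) r by (simp add: numerical_def)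
    then obtain z where z: "r = of_int z" by (auto elim: Ints_cases)
    have "min_coeffs p = [z]" using 1(2) by (subst min_coeffs.simps) (simp add: r z)
    then have "0 \<le> z" using 1(3) by simp
    then have "p = [:real (nat z):]" using r z by simp
    then show ?thesis
      using kolchin_poly_const[of "nat z"] True by (intro exI[of _ "{[nat z]}"]) simp
  next
    case False
    have mc: "min_coeffs p = std_coeff p (degree p) #
        replicate (degree p - length (min_coeffs (min_step p))) 0 @ min_coeffs (min_step p)"
      using 1(2) False by (subst min_coeffs.simps) (simp add: Let_def)
    have "\<exists>E\<subseteq>{x. length x = Suc (degree (min_step p))}.
        kolchin_poly_of (Suc (degree (min_step p))) E (min_step p)"
      using 1(1)[OF _ False numerical_min_step] 1(2,3) mc by simp
    then obtain E where E: "E \<subseteq> {x. length x = Suc (degree p)}"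
      "kolchin_poly_of (Suc (degree p)) E (min_step p)"
      using kolchin_poly_of_ge[of "Suc (degree (min_step p))" "min_step p" "Suc (degree p)"]
        degree_min_step[OF 1(2)] False by auto
    obtain a where a: "std_coeff p (degree p) = int a"
      using 1(3) mc nonneg_int_cases[of "std_coeff p (degree p)"] by auto
    have "(\<lambda>x. (a + hd x) # tl x) ` E \<subseteq> {x. length x = Suc (degree p)}" using E(1) by auto
    then show ?thesis using kolchin_poly_of_shift[OF 1(2) E a] by blast
  qed
qed

section \<open>Macaulay constants\<close>

lemma macaulay_const_nonneg_iff:
  assumes "numerical p"
  shows "sorted (macaulay_seq p) \<and> 0 \<le> macaulay_const p (degree p + 1) \<longleftrightarrow>
    (\<forall>b\<in>set (min_coeffs p). 0 \<le> b)"
proof -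
  let ?d = "degree p"
  have top: "macaulay_const p (?d + 1) = min_coeff p ?d"
    by (simp add: macaulay_const_def)
  have rec: "macaulay_const p (Suc j) = min_coeff p j + macaulay_const p (Suc (Suc j))" if "j < ?d" for j
    using that by (simp add: macaulay_const_def sum.atLeast_Suc_atMost)
  have "sorted (macaulay_seq p) \<longleftrightarrow>
      (\<forall>j. Suc j < length (map (macaulay_const p) [1..<?d + 2]) \<longrightarrow>
        map (macaulay_const p) [1..<?d + 2] ! Suc j \<le> map (macaulay_const p) [1..<?d + 2] ! j)"
    unfolding macaulay_seq_def by (simp only: rev_map[symmetric] sorted_rev_iff_nth_Suc)
  also have "\<dots> \<longleftrightarrow> (\<forall>j<?d. macaulay_const p (Suc (Suc j)) \<le> macaulay_const p (Suc j))"
    by (auto simp del: upt_Suc)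
  also have "\<dots> \<longleftrightarrow> (\<forall>j<?d. 0 \<le> min_coeff p j)"
    using rec by auto
  finally have "sorted (macaulay_seq p) \<and> 0 \<le> macaulay_const p (?d + 1) \<longleftrightarrow> (\<forall>j\<le>?d. 0 \<le> min_coeff p j)"
    unfolding top by (auto simp: le_less)
  also have "\<dots> \<longleftrightarrow> (\<forall>k\<le>?d. 0 \<le> min_coeffs p ! k)"
    unfolding min_coeff_def by (metis diff_diff_cancel diff_le_self)
  also have "\<dots> \<longleftrightarrow> (\<forall>b\<in>set (min_coeffs p). 0 \<le> b)"
    using length_min_coeffs[OF assms] by (simp add: all_set_conv_all_nth less_Suc_eq_le)
  finally show ?thesis .
qed

theorem corollary1:
  fixes \<omega> :: "real poly"
  assumes "numerical \<omega>"
  shows "is_kolchin_poly \<omega> \<longleftrightarrow>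
           sorted (macaulay_seq \<omega>) \<and> 0 \<le> macaulay_const \<omega> (degree \<omega> + 1)"
proof
  assume "is_kolchin_poly \<omega>"
  then show "sorted (macaulay_seq \<omega>) \<and> 0 \<le> macaulay_const \<omega> (degree \<omega> + 1)"
    unfolding macaulay_const_nonneg_iff[OF assms] is_kolchin_poly_def
    using kolchin_poly_min_coeffs_nonneg by blast
next
  assume "sorted (macaulay_seq \<omega>) \<and> 0 \<le> macaulay_const \<omega> (degree \<omega> + 1)"
  then show "is_kolchin_poly \<omega>"
    unfolding macaulay_const_nonneg_iff[OF assms] is_kolchin_poly_def
    using kolchin_poly_if_min_coeffs_nonneg[OF assms] by (metis le_add1 plus_1_eq_Suc)
qed

end
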